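(* Let $\mathfrak{L}$ be a finite-dimensional left Leibniz algebra over a field of characteristic zero, with Killing form $\kappa$. Then $\mathfrak{L}$ is solvable if, and only if, $\kappa(x,y)=0$ for every element $x\in\mathfrak{L}$ and every element $y\in\mathfrak{L}^2$.
   Context: A left Leibniz algebra is a vector space $\mathfrak{L}$ with a bilinear multiplication $(x,y)\mapsto xy$ satisfying $x(yz)=(xy)z+y(xz)$ for all $x,y,z\in\mathfrak{L}$. A product of two subspaces denotes the linear span of all products of their elements; $\mathfrak{L}^2:=\mathfrak{L}\mathfrak{L}$. The derived series is $\mathfrak{L}^{(0)}:=\mathfrak{L}$, $\mathfrak{L}^{(n+1)}:=\mathfrak{L}^{(n)}\mathfrak{L}^{(n)}$, and $\mathfrak{L}$ is solvable if $\mathfrak{L}^{(r)}=0$ for some non-negative integer $r$. For $x\in\mathfrak{L}$ let $L_x:\mathfrak{L}\to\mathfrak{L}$, $y\mapsto xy$. The Killing form of $\mathfrak{L}$ is $\kappa(x,y):=\mathrm{tr}(L_x\circ L_y)$. *)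

theory Defs
  imports Complex_Main
begin

text \<open>
  The algebra is the whole type \<open>'b\<close>, as in the locale \<^locale>\<open>vector_space\<close>.
\<close>

locale left_leibniz_algebra = vector_space scale
  for scale :: "'a::field \<Rightarrow> 'b::ab_group_add \<Rightarrow> 'b" +
  fixes mult :: "'b \<Rightarrow> 'b \<Rightarrow> 'b" (infixl "\<odot>" 70)
  assumes linear_mult_right: "Vector_Spaces.linear scale scale (\<lambda>y. x \<odot> y)"
    and linear_mult_left: "Vector_Spaces.linear scale scale (\<lambda>x. x \<odot> y)"
    and left_leibniz: "x \<odot> (y \<odot> z) = (x \<odot> y) \<odot> z + y \<odot> (x \<odot> z)"
begin

definition product_space :: "'b set \<Rightarrow> 'b set \<Rightarrow> 'b set"
  where "product_space A B = span {a \<odot> b | a b. a \<in> A \<and> b \<in> B}"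

primrec derived_series :: "nat \<Rightarrow> 'b set"
  where
    "derived_series 0 = UNIV"
  | "derived_series (Suc n) = product_space (derived_series n) (derived_series n)"

definition solvable :: bool
  where "solvable \<longleftrightarrow> (\<exists>r. derived_series r = {0})"

definition left_mult :: "'b \<Rightarrow> 'b \<Rightarrow> 'b"
  where "left_mult x = (\<lambda>y. x \<odot> y)"

end

context finite_dimensional_vector_space
begin

text \<open>
  The trace is the sum of the diagonal entries of the matrix of \<open>f\<close> with respect to the
  basis fixed by the locale; by \<open>endo_trace_eq\<close> below it does not depend on that basis.
\<close>

definition endo_trace :: "('b \<Rightarrow> 'b) \<Rightarrow> 'a"
  where "endo_trace f = (\<Sum>b\<in>Basis. representation Basis (f b) b)"

lemma endo_trace_eq:
  assumes f: "Vector_Spaces.linear scale scale f"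
    and B: "independent B" "span B = UNIV"
  shows "endo_trace f = (\<Sum>b\<in>B. representation B (f b) b)"
proof -
  interpret f: Vector_Spaces.linear scale scale f by (rule f)
  have finB: "finite B" using B(1) by (rule finiteI_independent)
  have eB: "(\<Sum>c\<in>B. scale (representation B v c) c) = v" for v
    by (rule sum_representation_eq) (use B finB in auto)
  have eBasis: "(\<Sum>c\<in>Basis. scale (representation Basis v c) c) = v" for v
    by (rule sum_representation_eq) (use finite_Basis independent_Basis span_Basis in auto)
  interpret rBasis: Vector_Spaces.linear scale "(*)" "\<lambda>v. representation Basis v b" for b
    by (rule linear_representation) (use independent_Basis span_Basis in auto)
  interpret rB: Vector_Spaces.linear scale "(*)" "\<lambda>v. representation B v b" for b
    by (rule linear_representation) (use B in auto)
  have fb: "f b = (\<Sum>c\<in>B. scale (representation B b c) (f c))" for b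
    by (subst eB[of b, symmetric]) (simp add: f.sum f.scale)
  have "endo_trace f = (\<Sum>b\<in>Basis. \<Sum>c\<in>B. representation B b c * representation Basis (f c) b)"
    unfolding endo_trace_def
    by (intro sum.cong refl, subst fb) (simp only: rBasis.sum rBasis.scale)
  also have "\<dots> = (\<Sum>c\<in>B. \<Sum>b\<in>Basis. representation Basis (f c) b * representation B b c)"
    by (subst sum.swap) (simp add: mult.commute)
  also have "\<dots> = (\<Sum>c\<in>B. representation B (\<Sum>b\<in>Basis. scale (representation Basis (f c) b) b) c)"
    by (simp only: rB.sum rB.scale)
  also have "\<dots> = (\<Sum>c\<in>B. representation B (f c) c)"
    by (simp only: eBasis)
  finally show ?thesis .
qed

end

locale finite_dimensional_left_leibniz_algebra =
  finite_dimensional_vector_space scale Basis + left_leibniz_algebra scale mult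
  for scale :: "'a::field \<Rightarrow> 'b::ab_group_add \<Rightarrow> 'b"
    and Basis :: "'b set"
    and mult :: "'b \<Rightarrow> 'b \<Rightarrow> 'b" (infixl "\<odot>" 70)
begin

definition killing_form :: "'b \<Rightarrow> 'b \<Rightarrow> 'a"
  where "killing_form x y = endo_trace (left_mult x \<circ> left_mult y)"

end

end

theory Submission
  imports Defs "HOL-Algebra.Algebraic_Closure_Type"
begin

text \<open>
  Left multiplications satisfy \<open>L\<^bsub>xy\<^esub> = [L\<^sub>x, L\<^sub>y]\<close>. By an Engel argument, a set of elements that is
  closed under multiplication and whose left multiplications are nilpotent acts nilpotently
  (a bounded number of its left multiplications compose to zero), and if \<open>\<LL>\<^sup>2\<close> acts nilpotently
  then \<open>\<LL>\<close> is solvable and \<open>L\<^sub>xL\<^sub>y\<close> is nilpotent for \<open>y \<in> \<LL>\<^sup>2\<close>. So both directions amount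
  to showing that \<open>L\<^sub>y\<close> is nilpotent for every \<open>y \<in> \<LL>\<^sup>2\<close>.

  If \<open>\<LL>\<close> is solvable, descend along the derived series: when \<open>D\<^bsup>(i+1)\<^esup>\<close> acts nilpotently, all
  traces \<open>tr L\<^sub>z\<^sup>k\<close> vanish, first for the products \<open>z = xy\<close> with \<open>y \<in> D\<^bsup>(i)\<^esup>\<close> and then for
  \<open>z \<in> D\<^bsup>(i)\<^esup>\<close>, since \<open>L\<^sub>z\<close> is a sum of commutators \<open>[L\<^sub>a, L\<^sub>b]\<close> with \<open>L\<^sub>b\<close> commuting with \<open>L\<^sub>z\<close> up to
  operators that act nilpotently.

  If the Killing form vanishes on \<open>\<LL> \<times> \<LL>\<^sup>2\<close>, use Chevalley's replicas: for an additive map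
  \<open>\<phi>\<close> from the algebraic closure to the rationals there are polynomials \<open>q\<close>, \<open>r\<close> with \<open>r(0) = 0\<close>,
  \<open>q(f) = \<phi>(a)\<close> on the generalised eigenspace of \<open>a\<close>, and \<open>ad q(f) = r(ad f)\<close>. For \<open>f = L\<^sub>y\<close> this
  forces \<open>tr (f q(f)) = \<Sum>a \<phi>(a) = 0\<close> (sum over the eigenvalues \<open>a\<close>), and applying \<open>\<phi>\<close> gives
  \<open>\<Sum>\<phi>(a)\<^sup>2 = 0\<close>. No extension of scalars of \<open>\<LL>\<close> is needed: the coefficients of \<open>q\<close> and \<open>r\<close> are
  pushed back to the ground field by linear functionals.
\<close>

section \<open>Polynomials, comaximality and two-generated ideals\<close>

text \<open>Substitution of \<open>g i\<close> for the i-th power. Each coefficient is handed to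
  \<open>g\<close>, so that a merely additive map can act on it; nested, this evaluates polynomials
  in two variables.\<close>

definition umbral_sum :: "(nat \<Rightarrow> 'a::zero \<Rightarrow> 'm::comm_monoid_add) \<Rightarrow> 'a poly \<Rightarrow> 'm"
  where "umbral_sum g p = (\<Sum>i\<le>degree p. g i (coeff p i))"

lemma umbral_sum_bound:
  assumes "degree p \<le> n" "\<And>i. g i 0 = 0"
  shows "umbral_sum g p = (\<Sum>i\<le>n. g i (coeff p i))"
  unfolding umbral_sum_def
  by (rule sum.mono_neutral_left) (use assms in \<open>auto simp: coeff_eq_0\<close>)

lemma umbral_sum_0 [simp]: "g 0 0 = 0 \<Longrightarrow> umbral_sum g 0 = 0"
  by (simp add: umbral_sum_def)

lemma umbral_sum_pCons:
  assumes "\<And>i. g i 0 = 0"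
  shows "umbral_sum g (pCons a p) = g 0 a + umbral_sum (\<lambda>i. g (Suc i)) p"
proof -
  have "umbral_sum g (pCons a p) = (\<Sum>i\<le>Suc (degree p). g i (coeff (pCons a p) i))"
    by (rule umbral_sum_bound) (use assms in \<open>auto simp: degree_pCons_le\<close>)
  also have "\<dots> = g 0 a + (\<Sum>i\<le>degree p. g (Suc i) (coeff p i))"
    by (subst sum.atMost_Suc_shift) simp
  finally show ?thesis by (simp add: umbral_sum_def)
qed

lemma umbral_sum_add:
  assumes "\<And>i. g i 0 = 0" "\<And>i a b. g i (a + b) = g i a + g i b"
  shows "umbral_sum g (p + q) = umbral_sum g p + umbral_sum g q"
proof -
  define n where "n = max (degree p) (degree q)"
  have "umbral_sum g (p + q) = (\<Sum>i\<le>n. g i (coeff (p + q) i))"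
    by (rule umbral_sum_bound) (use assms in \<open>auto simp: n_def degree_add_le_max\<close>)
  moreover have "umbral_sum g p = (\<Sum>i\<le>n. g i (coeff p i))"
    by (rule umbral_sum_bound) (use assms in \<open>auto simp: n_def\<close>)
  moreover have "umbral_sum g q = (\<Sum>i\<le>n. g i (coeff q i))"
    by (rule umbral_sum_bound) (use assms in \<open>auto simp: n_def\<close>)
  ultimately show ?thesis by (simp add: assms sum.distrib)
qed

lemma umbral_sum_smult:
  fixes p :: "'a::comm_semiring_0 poly"
  assumes "\<And>i. g i 0 = 0"
  shows "umbral_sum g (smult a p) = umbral_sum (\<lambda>i c. g i (a * c)) p"
proof -
  have "umbral_sum g (smult a p) = (\<Sum>i\<le>degree p. g i (coeff (smult a p) i))"
    by (rule umbral_sum_bound) (use assms in \<open>auto simp: degree_smult_le\<close>)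
  then show ?thesis by (simp add: umbral_sum_def)
qed

lemma umbral_sum_hom:
  assumes "h 0 = 0" "\<And>x y. h (x + y) = h x + h y"
  shows "h (umbral_sum g p) = umbral_sum (\<lambda>i c. h (g i c)) p"
  using sum_comp_morphism[of h "\<lambda>i. g i (coeff p i)" "{..degree p}", OF assms]
  by (simp add: umbral_sum_def comp_def)

lemma umbral_sum_map_poly:
  assumes "h 0 = 0" "\<And>i. g i 0 = 0"
  shows "umbral_sum g (map_poly h p) = umbral_sum (\<lambda>i c. g i (h c)) p"
proof -
  have "umbral_sum g (map_poly h p) = (\<Sum>i\<le>degree p. g i (coeff (map_poly h p) i))"
    by (rule umbral_sum_bound) (use assms in \<open>auto intro: map_poly_degree_leq\<close>)
  then show ?thesis by (simp add: umbral_sum_def coeff_map_poly assms)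
qed

lemma umbral_sum_mult:
  fixes h :: "nat \<Rightarrow> 'a::comm_ring_1"
  shows "umbral_sum (\<lambda>k c. c * h k) (p * q) =
    umbral_sum (\<lambda>i c. c * umbral_sum (\<lambda>j d. d * h (i + j)) q) p"
proof (induction p arbitrary: h rule: pCons_induct)
  case 0
  then show ?case by simp
next
  case (pCons a p)
  have "umbral_sum (\<lambda>k c. c * h k) (pCons a p * q) =
     umbral_sum (\<lambda>k c. c * h k) (smult a q) + umbral_sum (\<lambda>k c. c * h k) (pCons 0 (p * q))"
    by (simp add: umbral_sum_add algebra_simps)
  also have "umbral_sum (\<lambda>k c. c * h k) (smult a q) = a * umbral_sum (\<lambda>k c. c * h k) q"
    using umbral_sum_smult[of "\<lambda>k c. c * h k" a q]
    by (simp add: umbral_sum_def sum_distrib_left mult.assoc)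
  also have "umbral_sum (\<lambda>k c. c * h k) (pCons 0 (p * q)) = umbral_sum (\<lambda>k c. c * h (Suc k)) (p * q)"
    by (simp add: umbral_sum_pCons)
  also have "\<dots> = umbral_sum (\<lambda>i c. c * umbral_sum (\<lambda>j d. d * h (Suc (i + j))) q) p"
    by (rule pCons.IH)
  finally show ?case by (simp add: umbral_sum_pCons)
qed

text \<open>A Bezout identity is demanded, not just the absence of common factors: for the
  polynomials in two variables met later this is strictly stronger.\<close>

definition comaximal :: "'a::comm_ring_1 \<Rightarrow> 'a \<Rightarrow> bool"
  where "comaximal x y \<longleftrightarrow> (\<exists>a b. a * x + b * y = 1)"

lemma comaximal_commute: "comaximal x y \<longleftrightarrow> comaximal y x"
  unfolding comaximal_def by (metis add.commute)

lemma comaximal_1 [simp]: "comaximal x 1"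
  unfolding comaximal_def by (rule exI[of _ 0], rule exI[of _ 1]) simp

lemma comaximal_mult_right:
  assumes "comaximal x y" "comaximal x z"
  shows "comaximal x (y * z)"
proof -
  obtain a b c d where "a * x + b * y = 1" "c * x + d * z = 1"
    using assms unfolding comaximal_def by blast
  then have "(a * x + b * y) * (c * x + d * z) = 1" by simp
  then have "(a * c * x + a * d * z + b * y * c) * x + (b * d) * (y * z) = 1"
    by (simp add: algebra_simps)
  then show ?thesis unfolding comaximal_def by blast
qed

lemma comaximal_prod_right:
  assumes "\<And>i. i \<in> A \<Longrightarrow> comaximal x (f i)"
  shows "comaximal x (\<Prod>i\<in>A. f i)"
  using assms by (induction A rule: infinite_finite_induct) (auto intro: comaximal_mult_right)

lemma comaximal_power_right: "comaximal x y \<Longrightarrow> comaximal x (y ^ n)"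
  by (induction n) (auto intro: comaximal_mult_right)

lemma comaximal_powers: "comaximal x y \<Longrightarrow> comaximal (x ^ n) (y ^ m)"
  by (metis comaximal_commute comaximal_power_right)

section \<open>Ideals generated by two elements\<close>

definition in_ideal2 :: "'a::comm_ring_1 \<Rightarrow> 'a \<Rightarrow> 'a \<Rightarrow> bool"
  where "in_ideal2 x y d \<longleftrightarrow> (\<exists>g h. d = x * g + y * h)"

lemma in_ideal2_commute: "in_ideal2 x y d \<longleftrightarrow> in_ideal2 y x d"
  unfolding in_ideal2_def by (metis add.commute)

lemma in_ideal2_left: "in_ideal2 x y (x * g)"
  unfolding in_ideal2_def by (rule exI[of _ g], rule exI[of _ 0]) simp

lemma in_ideal2_right: "in_ideal2 x y (y * h)"
  unfolding in_ideal2_def by (rule exI[of _ 0], rule exI[of _ h]) simp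

lemma in_ideal2_add: "in_ideal2 x y d \<Longrightarrow> in_ideal2 x y e \<Longrightarrow> in_ideal2 x y (d + e)"
  unfolding in_ideal2_def by clarify (metis (no_types) add.assoc add.left_commute distrib_left)

lemma in_ideal2_of_multiples: "in_ideal2 (x * g) (y * h) d \<Longrightarrow> in_ideal2 x y d"
  unfolding in_ideal2_def by (metis mult.assoc)

lemma in_ideal2_mult_comaximal:
  assumes "in_ideal2 x y d" "in_ideal2 x z d" "comaximal y z"
  shows "in_ideal2 x (y * z) d"
proof -
  obtain g h where 1: "d = x * g + y * h" using assms(1) unfolding in_ideal2_def by blast
  obtain g' h' where 2: "d = x * g' + z * h'" using assms(2) unfolding in_ideal2_def by blast
  obtain a b where ab: "a * y + b * z = 1" using assms(3) unfolding comaximal_def by blast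
  have "d = a * y * d + b * z * d" using ab by (metis distrib_right mult_1)
  also have "\<dots> = a * y * (x * g' + z * h') + b * z * (x * g + y * h)" using 1 2 by simp
  also have "\<dots> = x * (a * y * g' + b * z * g) + (y * z) * (a * h' + b * h)"
    by (simp add: algebra_simps)
  finally show ?thesis unfolding in_ideal2_def by blast
qed

lemma in_ideal2_prod:
  assumes "finite A" "\<And>i. i \<in> A \<Longrightarrow> in_ideal2 x (f i) d"
    and "\<And>i j. i \<in> A \<Longrightarrow> j \<in> A \<Longrightarrow> i \<noteq> j \<Longrightarrow> comaximal (f i) (f j)"
  shows "in_ideal2 x (\<Prod>i\<in>A. f i) d"
  using assms
proof (induction A rule: finite_induct)
  case empty
  show ?case using in_ideal2_right[of x 1 d] by simp
next
  case (insert a A)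
  have "comaximal (f a) (\<Prod>i\<in>A. f i)"
    using insert by (intro comaximal_prod_right) auto
  then show ?case using insert by (auto intro: in_ideal2_mult_comaximal)
qed

lemma prod_dvd_of_comaximal:
  assumes "finite A" "\<And>i. i \<in> A \<Longrightarrow> f i dvd d"
    and "\<And>i j. i \<in> A \<Longrightarrow> j \<in> A \<Longrightarrow> i \<noteq> j \<Longrightarrow> comaximal (f i) (f j)"
  shows "(\<Prod>i\<in>A. f i) dvd d"
proof -
  have "in_ideal2 0 (f i) d" if "i \<in> A" for i
    using assms(2)[OF that] by (auto simp: dvd_def intro: in_ideal2_right)
  then have "in_ideal2 0 (\<Prod>i\<in>A. f i) d"
    by (rule in_ideal2_prod[OF assms(1) _ assms(3)])
  then show ?thesis by (auto simp: in_ideal2_def)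
qed

text \<open>In the binomial expansion every term contains \<open>x ^ m\<close> or
  \<open>y ^ k\<close>; splitting off one factor \<open>x + y\<close> at a time avoids the
  coefficients.\<close>

lemma in_ideal2_add_power: "in_ideal2 (x ^ m) (y ^ k) ((x + y) ^ (m + k))"
proof (induction "m + k" arbitrary: m k)
  case 0
  then show ?case using in_ideal2_left[of 1 1 1] by simp
next
  case (Suc n)
  show ?case
  proof (cases m; cases k)
    fix m' k' assume mk: "m = Suc m'" "k = Suc k'"
    have 1: "in_ideal2 (x ^ m) (y ^ k) (x * (x + y) ^ n)"
    proof -
      obtain g h where "(x + y) ^ n = x ^ m' * g + y ^ k * h"
        using Suc(1)[of m' k] Suc(2) mk unfolding in_ideal2_def by auto
      then have "x * (x + y) ^ n = x ^ m * g + y ^ k * (x * h)" by (simp add: mk algebra_simps)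
      then show ?thesis unfolding in_ideal2_def by blast
    qed
    have 2: "in_ideal2 (x ^ m) (y ^ k) (y * (x + y) ^ n)"
    proof -
      obtain g h where "(x + y) ^ n = x ^ m * g + y ^ k' * h"
        using Suc(1)[of m k'] Suc(2) mk unfolding in_ideal2_def by auto
      then have "y * (x + y) ^ n = x ^ m * (y * g) + y ^ k * h" by (simp add: mk algebra_simps)
      then show ?thesis unfolding in_ideal2_def by blast
    qed
    have "(x + y) ^ (m + k) = x * (x + y) ^ n + y * (x + y) ^ n"
      using Suc(2) by (metis distrib_right power_Suc)
    then show ?thesis using in_ideal2_add[OF 1 2] by simp
  qed (use in_ideal2_left[of 1] in_ideal2_right[of _ 1] in auto)
qed

section \<open>Linear factors and interpolation modulo their powers\<close>

lemma comaximal_linear: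
  fixes a b :: "'a::field"
  assumes "a \<noteq> b"
  shows "comaximal [:-a, 1:] [:-b, 1:]"
proof -
  have "inverse (b - a) * b - inverse (b - a) * a = 1"
    using assms by (simp flip: right_diff_distrib)
  then have "[:inverse (b - a):] * [:-a, 1:] + [:- inverse (b - a):] * [:-b, 1:] = 1"
    by (simp add: one_pCons mult.commute)
  then show ?thesis unfolding comaximal_def by blast
qed

lemma chinese_remainder_poly:
  fixes g :: "'a::field \<Rightarrow> 'a"
  assumes "finite S"
  shows "\<exists>p. \<forall>c\<in>S. [:-c, 1:] ^ n dvd p - [:g c:]"
  using assms
proof (induction S rule: finite_induct)
  case empty
  then show ?case by simp
next
  case (insert c S)
  then obtain p where p: "\<And>b. b \<in> S \<Longrightarrow> [:-b, 1:] ^ n dvd p - [:g b:]" by blast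
  let ?x = "[:-c, 1:] ^ n" and ?y = "\<Prod>b\<in>S. [:-b, 1:] ^ n"
  have "comaximal ?x ?y"
    using insert by (intro comaximal_prod_right comaximal_powers comaximal_linear) auto
  then obtain a b where ab: "a * ?x + b * ?y = 1" unfolding comaximal_def by blast
  \<comment> \<open>The Bezout summand \<open>b * ?y\<close> is 1 modulo \<open>?x\<close> and 0
    modulo \<open>?y\<close>, so \<open>p'\<close> takes the new value at \<open>c\<close> and
    agrees with \<open>p\<close> at the points of \<open>S\<close>.\<close>
  define p' where "p' = p * a * ?x + [:g c:] * b * ?y"
  have "p' - p = p' - p * (a * ?x + b * ?y)" by (simp only: ab mult_1_right)
  then have 1: "p' - p = ?y * (b * ([:g c:] - p))" by (simp add: p'_def algebra_simps)
  have "p' - [:g c:] = p' - [:g c:] * (a * ?x + b * ?y)" by (simp only: ab mult_1_right)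
  then have 2: "p' - [:g c:] = ?x * (a * (p - [:g c:]))" by (simp add: p'_def algebra_simps)
  have "[:-d, 1:] ^ n dvd p' - [:g d:]" if "d \<in> S" for d
  proof -
    have "[:-d, 1:] ^ n dvd ?y" using that insert by (intro dvd_prodI) auto
    then have "[:-d, 1:] ^ n dvd p' - p" using 1 by simp
    then have "[:-d, 1:] ^ n dvd (p' - p) + (p - [:g d:])" using p[OF that] by (rule dvd_add)
    then show ?thesis by (simp only: add_diff_eq diff_add_cancel)
  qed
  moreover have "?x dvd p' - [:g c:]" using 2 by simp
  ultimately show ?case by blast
qed

section \<open>Traces of idempotent and nilpotent matrices\<close>

definition mat_mult :: "'i set \<Rightarrow> ('j \<Rightarrow> 'i \<Rightarrow> 'a) \<Rightarrow> ('i \<Rightarrow> 'k \<Rightarrow> 'a) \<Rightarrow> 'j \<Rightarrow> 'k \<Rightarrow> 'a::comm_semiring_0"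
  where "mat_mult I a b = (\<lambda>i j. \<Sum>k\<in>I. a i k * b k j)"

lemma mat_mult_assoc: "mat_mult K (mat_mult I a b) c = mat_mult I a (mat_mult K b c)"
  unfolding mat_mult_def
  by (intro ext) (simp add: sum_distrib_left sum_distrib_right mult.assoc sum.swap[of _ K])

lemma mat_mult_cong:
  assumes "\<And>i k. i \<in> J \<Longrightarrow> k \<in> I \<Longrightarrow> a i k = a' i k"
    and "\<And>k j. k \<in> I \<Longrightarrow> j \<in> J' \<Longrightarrow> b k j = b' k j"
    and "i \<in> J" "j \<in> J'"
  shows "mat_mult I a b i j = mat_mult I a' b' i j"
  unfolding mat_mult_def using assms by (intro sum.cong) auto

lemma trace_mat_mult_commute:
  "(\<Sum>i\<in>I. mat_mult K c d i i) = (\<Sum>k\<in>K. mat_mult I d c k k)"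
  unfolding mat_mult_def by (subst sum.swap) (simp add: mult.commute)

text \<open>Exponents are shifted: index \<open>n\<close> stands for the power n + 1, so that the
  identity matrix does not enter.\<close>

fun mat_pow :: "'i set \<Rightarrow> ('i \<Rightarrow> 'i \<Rightarrow> 'a) \<Rightarrow> nat \<Rightarrow> 'i \<Rightarrow> 'i \<Rightarrow> 'a::comm_semiring_0"
  where "mat_pow I e 0 = e" | "mat_pow I e (Suc n) = mat_mult I e (mat_pow I e n)"

text \<open>The last two conjuncts say that the columns of \<open>c\<close> and the rows of \<open>d\<close> are independent; a
  factorization with \<open>K\<close> as small as possible has this property.\<close>

definition rank_factorization ::
    "'i set \<Rightarrow> ('i \<Rightarrow> 'i \<Rightarrow> 'a::comm_semiring_0) \<Rightarrow> 'i set \<Rightarrow> ('i \<Rightarrow> 'i \<Rightarrow> 'a) \<Rightarrow> ('i \<Rightarrow> 'i \<Rightarrow> 'a) \<Rightarrow> bool"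
  where "rank_factorization I e K c d \<longleftrightarrow> finite K \<and>
    (\<forall>i\<in>I. \<forall>j\<in>I. e i j = mat_mult K c d i j) \<and>
    (\<forall>x. (\<forall>i\<in>I. (\<Sum>k\<in>K. c i k * x k) = 0) \<longrightarrow> (\<forall>k\<in>K. x k = 0)) \<and>
    (\<forall>x. (\<forall>j\<in>I. (\<Sum>k\<in>K. x k * d k j) = 0) \<longrightarrow> (\<forall>k\<in>K. x k = 0))"

lemma rank_factorization_exists:
  fixes e :: "'i \<Rightarrow> 'i \<Rightarrow> 'a::field"
  assumes "finite I"
  shows "\<exists>K c d. rank_factorization I e K c d"
proof -
  define P where "P = (\<lambda>K :: 'i set. finite K \<and> (\<exists>(c :: 'i \<Rightarrow> 'i \<Rightarrow> 'a) d. \<forall>i\<in>I. \<forall>j\<in>I. e i j = mat_mult K c d i j))"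
  have "P I"
    unfolding P_def mat_mult_def
    by (intro conjI assms exI[of _ e] exI[of _ "\<lambda>k j. if k = j then 1 else 0"])
      (simp add: assms if_distrib sum.delta cong: if_cong)
  then obtain K where K: "P K" and min: "\<And>K'. P K' \<Longrightarrow> card K \<le> card K'"
    using ex_has_least_nat[of P I card] by blast
  then obtain c d where fin: "finite K" and cd: "\<And>i j. i \<in> I \<Longrightarrow> j \<in> I \<Longrightarrow> e i j = mat_mult K c d i j"
    unfolding P_def by blast
  have not_smaller: "\<not> P (K - {k})" if "k \<in> K" for k
    using min[of "K - {k}"] that fin by (metis card_Diff1_less not_le)
  have left: "\<forall>k\<in>K. x k = 0" if x: "\<And>i. i \<in> I \<Longrightarrow> (\<Sum>k\<in>K. c i k * x k) = 0" for x
  proof (rule ccontr)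
    assume "\<not> (\<forall>k\<in>K. x k = 0)"
    then obtain m where m: "m \<in> K" "x m \<noteq> 0" by blast
    have cm: "c i m = - (\<Sum>k\<in>K - {m}. c i k * (x k / x m))" if "i \<in> I" for i
    proof -
      have "c i m * x m + (\<Sum>k\<in>K - {m}. c i k * x k) = 0"
        using x[OF that] sum.remove[OF fin m(1), of "\<lambda>k. c i k * x k"] by simp
      then have "c i m = - (\<Sum>k\<in>K - {m}. c i k * x k) / x m"
        using m(2) by (simp add: field_simps eq_neg_iff_add_eq_0)
      then show ?thesis by (simp add: sum_divide_distrib)
    qed
    \<comment> \<open>The column \<open>m\<close> of \<open>c\<close> is a combination of the
      others; its contribution moves into the rows of \<open>d\<close>, which gives a factorization
      over a smaller index set.\<close>
    have "e i j = mat_mult (K - {m}) c (\<lambda>k j. d k j - x k / x m * d m j) i j"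
      if "i \<in> I" "j \<in> I" for i j
    proof -
      have "e i j = c i m * d m j + (\<Sum>k\<in>K - {m}. c i k * d k j)"
        using cd[OF that] sum.remove[OF fin m(1), of "\<lambda>k. c i k * d k j"] by (simp add: mat_mult_def)
      then show ?thesis
        by (simp add: cm[OF that(1)] mat_mult_def sum_distrib_right right_diff_distrib
            sum_subtractf mult.assoc)
    qed
    then have "P (K - {m})" unfolding P_def using fin by blast
    then show False using not_smaller m by blast
  qed
  have right: "\<forall>k\<in>K. x k = 0" if x: "\<And>j. j \<in> I \<Longrightarrow> (\<Sum>k\<in>K. x k * d k j) = 0" for x
  proof (rule ccontr)
    assume "\<not> (\<forall>k\<in>K. x k = 0)"
    then obtain m where m: "m \<in> K" "x m \<noteq> 0" by blast
    have dm: "d m j = - (\<Sum>k\<in>K - {m}. (x k / x m) * d k j)" if "j \<in> I" for j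
    proof -
      have "x m * d m j + (\<Sum>k\<in>K - {m}. x k * d k j) = 0"
        using x[OF that] sum.remove[OF fin m(1), of "\<lambda>k. x k * d k j"] by simp
      then have "d m j = - (\<Sum>k\<in>K - {m}. x k * d k j) / x m"
        using m(2) by (simp add: field_simps eq_neg_iff_add_eq_0)
      then show ?thesis by (simp add: sum_divide_distrib)
    qed
    have "e i j = mat_mult (K - {m}) (\<lambda>i k. c i k - c i m * (x k / x m)) d i j"
      if "i \<in> I" "j \<in> I" for i j
    proof -
      have "e i j = c i m * d m j + (\<Sum>k\<in>K - {m}. c i k * d k j)"
        using cd[OF that] sum.remove[OF fin m(1), of "\<lambda>k. c i k * d k j"] by (simp add: mat_mult_def)
      then show ?thesis
        by (simp add: dm[OF that(2)] mat_mult_def sum_distrib_left left_diff_distrib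
            sum_subtractf mult.assoc)
    qed
    then have "P (K - {m})" unfolding P_def using fin by blast
    then show False using not_smaller m by blast
  qed
  have "rank_factorization I e K c d"
    unfolding rank_factorization_def
    by (intro conjI fin ballI cd allI impI left right) auto
  then show ?thesis by blast
qed

lemma rank_factorization_cancel:
  assumes "rank_factorization I e K c d"
    and zero: "\<And>i j. i \<in> I \<Longrightarrow> j \<in> I \<Longrightarrow> mat_mult K c (mat_mult K g d) i j = 0"
    and "k \<in> K" "l \<in> K"
  shows "g k l = 0"
proof -
  have c: "(\<forall>i\<in>I. (\<Sum>k\<in>K. c i k * x k) = 0) \<longrightarrow> (\<forall>k\<in>K. x k = 0)"
    and d: "(\<forall>j\<in>I. (\<Sum>k\<in>K. x k * d k j) = 0) \<longrightarrow> (\<forall>k\<in>K. x k = 0)" for x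
    using assms(1) unfolding rank_factorization_def by blast+
  have "mat_mult K g d k j = 0" if "k \<in> K" "j \<in> I" for k j
    using c[of "\<lambda>k. mat_mult K g d k j"] zero that unfolding mat_mult_def[of K c] by simp
  then show ?thesis
    using d[of "g k"] assms(3,4) unfolding mat_mult_def by simp
qed

text \<open>For \<open>e = c d\<close> and \<open>g = d c\<close>, idempotency gives
  \<open>c (g - 1) d = 0\<close>, hence \<open>g = 1\<close> by cancellation. The trace of
  \<open>e\<close> equals that of \<open>g\<close>, which is the size of \<open>K\<close>.\<close>

lemma trace_idempotent_matrix:
  fixes e :: "'i \<Rightarrow> 'i \<Rightarrow> 'a::field_char_0"
  assumes fin: "finite I" and e: "\<And>i j. i \<in> I \<Longrightarrow> j \<in> I \<Longrightarrow> mat_mult I e e i j = e i j"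
  obtains r :: nat where "(\<Sum>i\<in>I. e i i) = of_nat r" "r = 0 \<Longrightarrow> \<forall>i\<in>I. \<forall>j\<in>I. e i j = 0"
proof -
  obtain K c d where cd: "rank_factorization I e K c d"
    using rank_factorization_exists[OF fin] by blast
  then have K: "finite K" and ecd: "\<And>i j. i \<in> I \<Longrightarrow> j \<in> I \<Longrightarrow> e i j = mat_mult K c d i j"
    by (auto simp: rank_factorization_def)
  define g where "g = mat_mult I d c"
  define h where "h = (\<lambda>k l. g k l - (if k = l then 1 else 0))"
  have hd: "mat_mult K h d k j = mat_mult K g d k j - d k j" if "k \<in> K" for k j
    using that K
    by (simp add: h_def mat_mult_def left_diff_distrib sum_subtractf if_distrib[of "\<lambda>x. x * _"] cong: if_cong)
  have "mat_mult K c (mat_mult K h d) i j = 0" if ij: "i \<in> I" "j \<in> I" for i j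
  proof -
    have "mat_mult K c (mat_mult K h d) i j
        = mat_mult K c (mat_mult K g d) i j - mat_mult K c d i j"
      unfolding mat_mult_def[of K c] by (simp add: hd right_diff_distrib sum_subtractf)
    also have "mat_mult K c (mat_mult K g d) i j = mat_mult I (mat_mult K c d) (mat_mult K c d) i j"
      by (simp add: g_def mat_mult_assoc)
    also have "\<dots> = mat_mult I e e i j"
      using ecd ij by (intro mat_mult_cong[of I I]) auto
    finally show ?thesis using e[OF ij] ecd[OF ij] by simp
  qed
  then have "h k l = 0" if "k \<in> K" "l \<in> K" for k l
    using rank_factorization_cancel[OF cd] that by blast
  then have g: "g k k = 1" if "k \<in> K" for k
    using that by (force simp: h_def)
  have "(\<Sum>i\<in>I. e i i) = (\<Sum>i\<in>I. mat_mult K c d i i)" using ecd by simp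
  also have "\<dots> = of_nat (card K)"
    by (simp add: trace_mat_mult_commute[of K c d I] g flip: g_def)
  finally have tr: "(\<Sum>i\<in>I. e i i) = of_nat (card K)" .
  have "\<forall>i\<in>I. \<forall>j\<in>I. e i j = 0" if "card K = 0"
  proof -
    have "K = {}" using that K by simp
    then show ?thesis using ecd unfolding mat_mult_def by simp
  qed
  with tr show ?thesis by (rule that)
qed

text \<open>Passing from \<open>e = c d\<close> to \<open>g = d c\<close> keeps the trace and lowers
  the nilpotency exponent by one, since \<open>c g d = e e\<close> and likewise for higher
  powers.\<close>

lemma trace_nilpotent_matrix:
  fixes e :: "'i \<Rightarrow> 'i \<Rightarrow> 'a::field"
  assumes "finite I" "\<And>i j. i \<in> I \<Longrightarrow> j \<in> I \<Longrightarrow> mat_pow I e n i j = 0"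
  shows "(\<Sum>i\<in>I. e i i) = 0"
  using assms
proof (induction n arbitrary: I e)
  case 0
  then show ?case by simp
next
  case (Suc n)
  obtain K c d where cd: "rank_factorization I e K c d"
    using rank_factorization_exists[OF Suc.prems(1)] by blast
  then have K: "finite K" and ecd: "\<And>i j. i \<in> I \<Longrightarrow> j \<in> I \<Longrightarrow> e i j = mat_mult K c d i j"
    by (auto simp: rank_factorization_def)
  define g where "g = mat_mult I d c"
  have pow: "mat_pow I e (Suc m) i j = mat_mult K c (mat_mult K (mat_pow K g m) d) i j"
    if "i \<in> I" "j \<in> I" for i j m
    using that
  proof (induction m arbitrary: i j)
    case 0
    have "mat_mult I e e i j = mat_mult I (mat_mult K c d) (mat_mult K c d) i j"
      using ecd 0 by (intro mat_mult_cong[of I I]) auto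
    then show ?case by (simp add: g_def mat_mult_assoc)
  next
    case (Suc m)
    have "mat_pow I e (Suc (Suc m)) i j
        = mat_mult I (mat_mult K c d) (mat_mult K c (mat_mult K (mat_pow K g m) d)) i j"
      unfolding mat_pow.simps(2)[of I e "Suc m"]
      using ecd Suc by (intro mat_mult_cong[of I I]) auto
    then show ?case by (simp add: g_def mat_mult_assoc)
  qed
  have "mat_pow K g n k l = 0" if "k \<in> K" "l \<in> K" for k l
    using rank_factorization_cancel[OF cd, of "mat_pow K g n"] that pow Suc.prems(2) by simp
  then have "(\<Sum>k\<in>K. g k k) = 0" by (intro Suc.IH K) auto
  moreover have "(\<Sum>i\<in>I. e i i) = (\<Sum>i\<in>I. mat_mult K c d i i)" using ecd by simp
  ultimately show ?case by (simp add: trace_mat_mult_commute[of K c d I] g_def)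
qed

section \<open>Polynomials in two variables\<close>

text \<open>Polynomials in two variables \<open>u\<close>, \<open>v\<close> are polynomials in \<open>u\<close> over the polynomials in \<open>v\<close>.\<close>

definition poly_at :: "'a::comm_ring_1 poly \<Rightarrow> 'a poly poly \<Rightarrow> 'a poly poly"
  where "poly_at p w = poly (map_poly (\<lambda>c. [:[:c:]:]) p) w"

lemma poly_at_0 [simp]: "poly_at 0 w = 0"
  by (simp add: poly_at_def)

lemma poly_at_pCons [simp]: "poly_at (pCons a p) w = [:[:a:]:] + w * poly_at p w"
  by (simp add: poly_at_def map_poly_pCons)

lemma poly_at_1 [simp]: "poly_at 1 w = 1"
  by (simp only: one_pCons poly_at_pCons) simp

lemma poly_at_add: "poly_at (p + q) w = poly_at p w + poly_at q w"
  by (induction p q rule: poly_induct2) (simp_all add: algebra_simps)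

lemma poly_at_smult: "poly_at (smult a p) w = [:[:a:]:] * poly_at p w"
  by (induction p) (simp_all add: algebra_simps)

lemma poly_at_mult: "poly_at (p * q) w = poly_at p w * poly_at q w"
  by (induction p) (simp_all add: poly_at_add poly_at_smult algebra_simps)

lemma poly_at_power: "poly_at (p ^ n) w = poly_at p w ^ n"
  by (induction n) (simp_all add: poly_at_mult)

lemma poly_at_prod: "poly_at (\<Prod>i\<in>A. f i) w = (\<Prod>i\<in>A. poly_at (f i) w)"
  by (induction A rule: infinite_finite_induct) (simp_all add: poly_at_mult)

lemma comaximal_poly_at: "comaximal p q \<Longrightarrow> comaximal (poly_at p w) (poly_at q w)"
  unfolding comaximal_def by (metis poly_at_1 poly_at_add poly_at_mult)

abbreviation (input) "var_u \<equiv> [:0, 1:]"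
abbreviation (input) "var_v \<equiv> [:[:0, 1:]:]"

text \<open>Modulo the local factor of \<open>a\<close> at \<open>x\<close> and that of
  \<open>b\<close> at \<open>y\<close>, the three terms become the constants \<open>g a\<close>,
  \<open>g b\<close> and \<open>g a - g b\<close>, which cancel. Comaximality glues these local
  statements.\<close>

lemma in_ideal2_poly_at_diff:
  fixes S :: "'a::field set" and g :: "'a \<Rightarrow> 'a"
  assumes fin: "finite S"
    and q: "\<And>a. a \<in> S \<Longrightarrow> [:-a, 1:] ^ n dvd q - [:g a:]"
    and p: "\<And>a b. a \<in> S \<Longrightarrow> b \<in> S \<Longrightarrow> [:-(a - b), 1:] ^ (n + n) dvd p - [:g a - g b:]"
  shows "in_ideal2 (poly_at (\<Prod>a\<in>S. [:-a, 1:] ^ n) x) (poly_at (\<Prod>a\<in>S. [:-a, 1:] ^ n) y)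
    (poly_at q x - poly_at q y - poly_at p (x - y))" (is "in_ideal2 _ _ ?d")
proof -
  let ?l = "\<lambda>a w. poly_at ([:-a, 1:] ^ n) w"
  have local: "in_ideal2 (?l a x) (?l b y) ?d" if ab: "a \<in> S" "b \<in> S" for a b
  proof -
    obtain q1 where "q - [:g a:] = [:-a, 1:] ^ n * q1" using q[OF ab(1)] by blast
    then have q1: "q = [:g a:] + [:-a, 1:] ^ n * q1" by (metis add.commute diff_add_cancel)
    obtain q2 where "q - [:g b:] = [:-b, 1:] ^ n * q2" using q[OF ab(2)] by blast
    then have q2: "q = [:g b:] + [:-b, 1:] ^ n * q2" by (metis add.commute diff_add_cancel)
    obtain p1 where "p - [:g a - g b:] = [:-(a - b), 1:] ^ (n + n) * p1" using p[OF ab] by blast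
    then have p1: "p = [:g a - g b:] + [:-(a - b), 1:] ^ (n + n) * p1"
      by (metis add.commute diff_add_cancel)
    \<comment> \<open>Since x - y - (a - b) is the sum of x - a and -(y - b), its power of exponent
      \<open>n + n\<close> lies in the ideal of the two n-th powers. This is why \<open>p\<close> is
      controlled to the doubled exponent.\<close>
    have sub: "poly_at [:-(a - b), 1:] (x - y) = poly_at [:-a, 1:] x + - poly_at [:-b, 1:] y"
      by (simp add: algebra_simps flip: one_pCons)
    have "in_ideal2 (?l a x) ((- poly_at [:-b, 1:] y) ^ n)
        (poly_at ([:-(a - b), 1:] ^ (n + n)) (x - y))"
      unfolding poly_at_power sub by (rule in_ideal2_add_power)
    then obtain h1 h2 where
      "poly_at ([:-(a - b), 1:] ^ (n + n)) (x - y) = ?l a x * h1 + (- poly_at [:-b, 1:] y) ^ n * h2"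
      unfolding in_ideal2_def by blast
    moreover have "(- poly_at [:-b, 1:] y) ^ n = ?l b y * (- 1) ^ n"
      unfolding poly_at_power by (metis mult.commute power_minus)
    ultimately have P: "poly_at p (x - y) = [:[:g a - g b:]:]
        + (?l a x * h1 + ?l b y * ((- 1) ^ n * h2)) * poly_at p1 (x - y)"
      by (subst p1, subst poly_at_add, subst poly_at_mult) (simp add: mult.assoc)
    have Q1: "poly_at q x = [:[:g a:]:] + ?l a x * poly_at q1 x"
      by (subst q1, subst poly_at_add, subst poly_at_mult) simp
    have Q2: "poly_at q y = [:[:g b:]:] + ?l b y * poly_at q2 y"
      by (subst q2, subst poly_at_add, subst poly_at_mult) simp
    have const: "[:[:g a - g b:]:] = [:[:g a:]:] - [:[:g b:]:]" by simp
    have ring: "(s + e * f) - (t + k * l) - (s - t + (e * h + k * z) * r)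
        = e * (f - h * r) + k * (- l - z * r)" for s t e f k l h z r :: "'a poly poly"
      by (simp add: algebra_simps)
    have "?d = ?l a x * (poly_at q1 x - h1 * poly_at p1 (x - y))
      + ?l b y * (- poly_at q2 y - (- 1) ^ n * h2 * poly_at p1 (x - y))"
      unfolding P Q1 Q2 const by (rule ring)
    then show ?thesis unfolding in_ideal2_def by blast
  qed
  have comax: "comaximal (?l a w) (?l b w)" if "a \<noteq> b" for a b :: 'a and w
    by (intro comaximal_poly_at comaximal_powers comaximal_linear that)
  have "in_ideal2 (?l a x) (\<Prod>b\<in>S. ?l b y) ?d" if "a \<in> S" for a
    by (rule in_ideal2_prod[OF fin]) (use local comax that in auto)
  then have "in_ideal2 (\<Prod>b\<in>S. ?l b y) (\<Prod>a\<in>S. ?l a x) ?d"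
    by (intro in_ideal2_prod[OF fin]) (use comax in \<open>auto simp: in_ideal2_commute\<close>)
  then show ?thesis by (simp add: poly_at_prod in_ideal2_commute)
qed

section \<open>Traces of polynomials in an endomorphism\<close>

context finite_dimensional_vector_space
begin

section \<open>Endomorphisms and their traces in coordinates\<close>

abbreviation (input) endo :: "('b \<Rightarrow> 'b) \<Rightarrow> bool"
  where "endo \<equiv> Vector_Spaces.linear scale scale"

lemma endo_iff:
  "endo f \<longleftrightarrow> (\<forall>x y. f (x + y) = f x + f y) \<and> (\<forall>c x. f (scale c x) = scale c (f x))"
  using vector_space_axioms by (auto simp: Vector_Spaces.linear_iff)

lemma endo_ident: "endo (\<lambda>v. v)" and endo_zero: "endo (\<lambda>v. 0)"
  and endo_scale: "endo (scale c)"
  by (auto simp: endo_iff scale_right_distrib mult.commute)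

lemma endo_compose: "endo f \<Longrightarrow> endo g \<Longrightarrow> endo (\<lambda>v. f (g v))"
  and endo_add: "endo f \<Longrightarrow> endo g \<Longrightarrow> endo (\<lambda>v. f v + g v)"
  and endo_diff: "endo f \<Longrightarrow> endo g \<Longrightarrow> endo (\<lambda>v. f v - g v)"
  by (auto simp: endo_iff scale_right_distrib scale_right_diff_distrib)

lemma endo_funpow:
  assumes "endo f" shows "endo (f ^^ n)"
  by (induction n) (simp_all add: endo_ident id_def comp_def endo_compose assms)

lemma representation_Basis_linear:
  "Vector_Spaces.linear scale (*) (\<lambda>v. representation Basis v b)"
  by (rule linear_representation) (use independent_Basis span_Basis in auto)

lemma sum_representation_Basis: "(\<Sum>c\<in>Basis. scale (representation Basis v c) c) = v"
  by (rule sum_representation_eq) (use finite_Basis independent_Basis span_Basis in auto)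

lemma endo_expand:
  assumes "endo f"
  shows "f v = (\<Sum>c\<in>Basis. scale (representation Basis v c) (f c))"
proof -
  interpret f: Vector_Spaces.linear scale scale f by (rule assms)
  show ?thesis
    by (subst (1) sum_representation_Basis[of v, symmetric]) (simp add: f.sum f.scale)
qed

lemma representation_endo:
  assumes "endo f"
  shows "representation Basis (f v) i
    = (\<Sum>c\<in>Basis. representation Basis (f c) i * representation Basis v c)"
proof -
  interpret r: Vector_Spaces.linear scale "(*)" "\<lambda>v. representation Basis v i"
    by (rule representation_Basis_linear)
  show ?thesis
    by (subst endo_expand[OF assms]) (simp add: r.sum r.scale mult.commute)
qed

lemma endo_eq_0:
  assumes "endo f" "\<And>i j. i \<in> Basis \<Longrightarrow> j \<in> Basis \<Longrightarrow> representation Basis (f j) i = 0"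
  shows "f v = 0"
proof -
  have "f j = 0" if "j \<in> Basis" for j
    using sum_representation_Basis[of "f j"] assms(2) that by simp
  then show ?thesis using endo_expand[OF assms(1), of v] by simp
qed

lemma endo_trace_add: "endo_trace (\<lambda>v. f v + g v) = endo_trace f + endo_trace g"
  by (simp add: endo_trace_def representation_add independent_Basis span_Basis sum.distrib)

lemma endo_trace_diff: "endo_trace (\<lambda>v. f v - g v) = endo_trace f - endo_trace g"
  by (simp add: endo_trace_def representation_diff independent_Basis span_Basis sum_subtractf)

lemma endo_trace_scale: "endo_trace (\<lambda>v. scale c (f v)) = c * endo_trace f"
  by (simp add: endo_trace_def representation_scale independent_Basis span_Basis sum_distrib_left)

lemma endo_trace_0 [simp]: "endo_trace (\<lambda>v. 0) = 0"
  by (simp add: endo_trace_def representation_zero)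

lemma endo_trace_commute:
  assumes "endo f" "endo g"
  shows "endo_trace (\<lambda>v. f (g v)) = endo_trace (\<lambda>v. g (f v))"
proof -
  have "endo_trace (\<lambda>v. f (g v)) = (\<Sum>b\<in>Basis. \<Sum>c\<in>Basis.
      representation Basis (f c) b * representation Basis (g b) c)"
    unfolding endo_trace_def by (subst representation_endo[OF assms(1)]) simp
  also have "\<dots> = (\<Sum>c\<in>Basis. \<Sum>b\<in>Basis.
      representation Basis (g b) c * representation Basis (f c) b)"
    by (subst sum.swap) (simp add: mult.commute)
  also have "\<dots> = endo_trace (\<lambda>v. g (f v))"
    unfolding endo_trace_def by (subst (2) representation_endo[OF assms(2)]) simp
  finally show ?thesis .
qed

lemma endo_trace_nilpotent:
  assumes f: "endo f" and nil: "\<And>v. (f ^^ n) v = 0"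
  shows "endo_trace f = 0"
proof -
  define e where "e = (\<lambda>i j. representation Basis (f j) i)"
  have pow: "mat_pow Basis e m i j = representation Basis ((f ^^ Suc m) j) i" for m i j
  proof (induction m arbitrary: i j)
    case 0
    then show ?case by (simp add: e_def)
  next
    case (Suc m)
    show ?case
      unfolding mat_pow.simps mat_mult_def Suc.IH
      using representation_endo[OF f, of "(f ^^ Suc m) j" i] by (simp add: e_def)
  qed
  interpret f: Vector_Spaces.linear scale scale f by (rule f)
  have "(\<Sum>i\<in>Basis. e i i) = 0"
    by (rule trace_nilpotent_matrix[OF finite_Basis, of e n])
      (simp add: pow nil f.zero representation_zero)
  then show ?thesis by (simp add: endo_trace_def e_def)
qed

section \<open>Polynomials in an endomorphism\<close>

definition poly_endo :: "('b \<Rightarrow> 'b) \<Rightarrow> 'a poly \<Rightarrow> 'b \<Rightarrow> 'b"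
  where "poly_endo f p v = umbral_sum (\<lambda>i c. scale c ((f ^^ i) v)) p"

lemma poly_endo_0 [simp]: "poly_endo f 0 v = 0"
  by (simp add: poly_endo_def)

lemma poly_endo_pCons: "poly_endo f (pCons a p) v = scale a v + poly_endo f p (f v)"
  by (simp add: poly_endo_def umbral_sum_pCons funpow_swap1)

lemma poly_endo_add: "poly_endo f (p + q) v = poly_endo f p v + poly_endo f q v"
  by (simp add: poly_endo_def umbral_sum_add scale_left_distrib)

lemma poly_endo_smult: "poly_endo f (smult a p) v = scale a (poly_endo f p v)"
proof -
  have "poly_endo f (smult a p) v = umbral_sum (\<lambda>i c. scale (a * c) ((f ^^ i) v)) p"
    unfolding poly_endo_def by (subst umbral_sum_smult) simp_all
  then show ?thesis by (simp add: poly_endo_def umbral_sum_def scale_sum_right)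
qed

lemma endo_poly_endo:
  assumes "endo f" shows "endo (poly_endo f p)"
proof (induction p)
  case 0
  show ?case unfolding poly_endo_0[abs_def] by (rule endo_zero)
next
  case (pCons a p)
  show ?case
    unfolding poly_endo_pCons[abs_def]
    by (intro endo_add endo_scale endo_compose[OF pCons(2) assms])
qed

lemma poly_endo_mult:
  assumes "endo f"
  shows "poly_endo f (p * q) v = poly_endo f q (poly_endo f p v)"
proof (induction p arbitrary: v)
  case 0
  interpret q: Vector_Spaces.linear scale scale "poly_endo f q" by (rule endo_poly_endo[OF assms])
  show ?case by (simp add: q.zero)
next
  case (pCons a p)
  interpret q: Vector_Spaces.linear scale scale "poly_endo f q" by (rule endo_poly_endo[OF assms])
  show ?case
    by (simp add: poly_endo_add poly_endo_smult poly_endo_pCons pCons q.add q.scale)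
qed

text \<open>\<open>dependent\<close> speaks of sets, but the vectors \<open>x k\<close> form a
  family and may repeat; a repetition \<open>x i = x j\<close> gives a relation with coefficients 1
  and -1.\<close>

lemma exists_linear_relation:
  fixes x :: "nat \<Rightarrow> 'b"
  obtains c i where "(\<Sum>k\<le>dim UNIV. scale (c k) (x k)) = 0" "i \<le> dim UNIV" "c i \<noteq> 0"
proof (cases "inj_on x {..dim UNIV}")
  case True
  then have "card (x ` {..dim UNIV}) > dim UNIV" by (simp add: card_image)
  then have "dependent (x ` {..dim UNIV})"
    using independent_card_le_dim[of "x ` {..dim UNIV}" UNIV] by fastforce
  then obtain u v where uv: "v \<in> x ` {..dim UNIV}" "u v \<noteq> 0"
    "(\<Sum>v\<in>x ` {..dim UNIV}. scale (u v) v) = 0"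
    unfolding dependent_finite[OF finite_imageI[OF finite_atMost]] by blast
  then have "(\<Sum>k\<le>dim UNIV. scale (u (x k)) (x k)) = 0"
    unfolding sum.reindex[OF True] by (simp add: comp_def)
  then show ?thesis using that uv by auto
next
  case False
  then obtain i j where ij: "i \<le> dim UNIV" "j \<le> dim UNIV" "i \<noteq> j" "x i = x j"
    unfolding inj_on_def by auto
  define c :: "nat \<Rightarrow> 'a" where "c = (\<lambda>k. (if k = i then 1 else 0) - (if k = j then 1 else 0))"
  have d: "(\<Sum>k\<le>dim UNIV. scale (if k = l then 1 else 0) (x k)) = x l" if "l \<le> dim UNIV" for l
    using that by (simp add: if_distrib[of "\<lambda>c. scale c _"] cong: if_cong)
  have "(\<Sum>k\<le>dim UNIV. scale (c k) (x k)) = 0"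
    unfolding c_def scale_left_diff_distrib sum_subtractf d[OF ij(1)] d[OF ij(2)] using ij(4) by simp
  then show ?thesis using that[of c i] ij by (simp add: c_def)
qed

lemma exists_annihilating_poly:
  assumes f: "endo f"
  obtains p where "p \<noteq> 0" "\<And>v. poly_endo f p v = 0"
proof -
  have "\<exists>p. p \<noteq> 0 \<and> poly_endo f p v = 0" for v
  proof -
    obtain c i where c: "(\<Sum>k\<le>dim UNIV. scale (c k) ((f ^^ k) v)) = 0" "i \<le> dim UNIV" "c i \<noteq> 0"
      by (rule exists_linear_relation)
    define p where "p = (\<Sum>k\<le>dim UNIV. monom (c k) k)"
    have coeff: "coeff p k = (if k \<le> dim UNIV then c k else 0)" for k
      by (simp add: p_def coeff_sum)
    have "degree p \<le> dim UNIV" by (rule degree_le) (simp add: coeff)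
    then have "poly_endo f p v = 0"
      unfolding poly_endo_def by (subst umbral_sum_bound) (use c in \<open>auto simp: coeff\<close>)
    moreover have "p \<noteq> 0" using coeff[of i] c by auto
    ultimately show ?thesis by blast
  qed
  then obtain P where P: "\<And>v. P v \<noteq> 0" "\<And>v. poly_endo f (P v) v = 0" by metis
  define p where "p = (\<Prod>b\<in>Basis. P b)"
  interpret p: Vector_Spaces.linear scale scale "poly_endo f p" by (rule endo_poly_endo[OF f])
  have "poly_endo f p b = 0" if b: "b \<in> Basis" for b
  proof -
    interpret q: Vector_Spaces.linear scale scale "poly_endo f (\<Prod>b\<in>Basis - {b}. P b)"
      by (rule endo_poly_endo[OF f])
    have "p = P b * (\<Prod>b\<in>Basis - {b}. P b)"
      unfolding p_def using finite_Basis b by (rule prod.remove)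
    then show ?thesis using poly_endo_mult[OF f] P(2) q.zero by simp
  qed
  then have "poly_endo f p v = 0" for v
    using endo_expand[OF endo_poly_endo[OF f], of p v] by simp
  moreover have "p \<noteq> 0" unfolding p_def using P finite_Basis by simp
  ultimately show ?thesis using that by blast
qed

text \<open>The matrix of \<open>p(f)\<close> after extension of scalars to the algebraic closure.\<close>

definition mat_poly :: "('b \<Rightarrow> 'b) \<Rightarrow> 'a alg_closure poly \<Rightarrow> 'b \<Rightarrow> 'b \<Rightarrow> 'a alg_closure"
  where "mat_poly f p i j = umbral_sum (\<lambda>k c. c * to_ac (representation Basis ((f ^^ k) j) i)) p"

definition trace_poly :: "('b \<Rightarrow> 'b) \<Rightarrow> 'a alg_closure poly \<Rightarrow> 'a alg_closure"
  where "trace_poly f p = (\<Sum>i\<in>Basis. mat_poly f p i i)"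

lemma trace_poly_altdef:
  "trace_poly f p = umbral_sum (\<lambda>k c. c * to_ac (endo_trace (f ^^ k))) p"
  unfolding trace_poly_def mat_poly_def umbral_sum_def
  by (subst sum.swap) (simp add: endo_trace_def to_ac_sum sum_distrib_left)

lemma mat_poly_add: "mat_poly f (p + q) i j = mat_poly f p i j + mat_poly f q i j"
  by (simp add: mat_poly_def umbral_sum_add distrib_right)

lemma mat_poly_smult: "mat_poly f (smult a p) i j = a * mat_poly f p i j"
proof -
  have "mat_poly f (smult a p) i j
      = umbral_sum (\<lambda>k c. a * c * to_ac (representation Basis ((f ^^ k) j) i)) p"
    unfolding mat_poly_def by (subst umbral_sum_smult) simp_all
  then show ?thesis by (simp add: mat_poly_def umbral_sum_def sum_distrib_left mult.assoc)
qed

lemma mat_poly_0 [simp]: "mat_poly f 0 i j = 0"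
  by (simp add: mat_poly_def)

lemma mat_poly_diff: "mat_poly f (p - q) i j = mat_poly f p i j - mat_poly f q i j"
  using mat_poly_add[of f "p - q" q i j] by simp

lemma mat_poly_sum: "mat_poly f (\<Sum>a\<in>A. h a) i j = (\<Sum>a\<in>A. mat_poly f (h a) i j)"
  by (induction A rule: infinite_finite_induct) (simp_all add: mat_poly_add)

lemma mat_poly_mult:
  assumes "endo f"
  shows "mat_poly f (p * q) = mat_mult Basis (mat_poly f p) (mat_poly f q)"
proof (intro ext)
  fix i j
  let ?m = "\<lambda>k i j. to_ac (representation Basis ((f ^^ k) j) i)"
  have m: "?m (k + l) i j = (\<Sum>b\<in>Basis. ?m k i b * ?m l b j)" for k l
    using representation_endo[OF endo_funpow[OF assms], of k "(f ^^ l) j" i]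
    by (simp add: funpow_add to_ac_sum)
  have "mat_poly f (p * q) i j = umbral_sum (\<lambda>k c. c * umbral_sum (\<lambda>l d. d * ?m (k + l) i j) q) p"
    unfolding mat_poly_def by (rule umbral_sum_mult)
  also have "\<dots> = (\<Sum>k\<le>degree p. \<Sum>l\<le>degree q. \<Sum>b\<in>Basis.
      coeff p k * ?m k i b * (coeff q l * ?m l b j))"
    by (simp add: umbral_sum_def m sum_distrib_left mult_ac)
  also have "\<dots> = (\<Sum>b\<in>Basis. \<Sum>k\<le>degree p. \<Sum>l\<le>degree q.
      coeff p k * ?m k i b * (coeff q l * ?m l b j))"
    by (simp add: sum.swap[of _ Basis])
  also have "\<dots> = mat_mult Basis (mat_poly f p) (mat_poly f q) i j"
    by (simp add: mat_mult_def mat_poly_def umbral_sum_def sum_product)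
  finally show "mat_poly f (p * q) i j = mat_mult Basis (mat_poly f p) (mat_poly f q) i j" .
qed

lemma mat_poly_power:
  assumes "endo f"
  shows "mat_poly f (p ^ Suc n) = mat_pow Basis (mat_poly f p) n"
  by (induction n) (simp_all add: mat_poly_mult[OF assms])

lemma mat_poly_annihilated:
  assumes "\<And>v. poly_endo f p v = 0"
  shows "mat_poly f (map_poly to_ac p) i j = 0"
proof -
  interpret r: Vector_Spaces.linear scale "(*)" "\<lambda>v. representation Basis v i"
    by (rule representation_Basis_linear)
  have "mat_poly f (map_poly to_ac p) i j = to_ac (representation Basis (poly_endo f p j) i)"
    unfolding mat_poly_def poly_endo_def
    by (subst umbral_sum_map_poly) (simp_all add: umbral_sum_def r.sum r.scale to_ac_sum)
  then show ?thesis by (simp add: assms representation_zero)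
qed

end

section \<open>Eigenvalue multiplicities and power traces\<close>

locale finite_dimensional_vector_space_char_0 = finite_dimensional_vector_space scale Basis
  for scale :: "'a::field_char_0 \<Rightarrow> 'b::ab_group_add \<Rightarrow> 'b" and Basis
begin

lemma trace_poly_add: "trace_poly f (p + q) = trace_poly f p + trace_poly f q"
  by (simp add: trace_poly_def mat_poly_add sum.distrib)

lemma trace_poly_diff: "trace_poly f (p - q) = trace_poly f p - trace_poly f q"
  by (simp add: trace_poly_def mat_poly_diff sum_subtractf)

lemma trace_poly_smult: "trace_poly f (smult a p) = a * trace_poly f p"
  by (simp add: trace_poly_def mat_poly_smult sum_distrib_left)

lemma trace_poly_sum: "trace_poly f (\<Sum>a\<in>A. h a) = (\<Sum>a\<in>A. trace_poly f (h a))"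
  by (induction A rule: infinite_finite_induct) (simp_all add: trace_poly_add trace_poly_def[of _ 0])

text \<open>\<open>S\<close> collects the roots of an annihilating polynomial, and one exponent
  \<open>N\<close> bounds all multiplicities. Adding 0 to \<open>S\<close> lets later interpolation
  prescribe the constant term.\<close>

lemma exists_split_annihilating_poly:
  assumes f: "endo f"
  shows "\<exists>S N p. finite S \<and> 0 \<in> S \<and> N > 0 \<and> (\<forall>v. poly_endo f p v = 0) \<and>
    map_poly to_ac p dvd (\<Prod>a\<in>S. [:-a, 1:] ^ N)"
proof -
  obtain p where p: "p \<noteq> 0" "\<And>v. poly_endo f p v = 0"
    using exists_annihilating_poly[OF f] by blast
  have "map_poly to_ac p \<noteq> 0" using p(1) by (subst map_poly_eq_0_iff) auto
  then obtain A where A: "map_poly to_ac p = smult (lead_coeff (map_poly to_ac p)) (\<Prod>x\<in>#A. [:-x, 1:])"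
    using alg_closed_imp_factorization by metis
  define S where "S = insert 0 (set_mset A)"
  define N where "N = Suc (size A)"
  have "(\<Prod>x\<in>#A. [:-x, 1:]) = (\<Prod>x\<in>set_mset A. [:-x, 1:] ^ count A x)"
    by (rule image_prod_mset_multiplicity)
  also have "\<dots> dvd (\<Prod>x\<in>set_mset A. [:-x, 1:] ^ N)"
    by (intro prod_dvd_prod le_imp_power_dvd) (simp add: N_def count_le_size le_SucI)
  also have "\<dots> dvd (\<Prod>a\<in>S. [:-a, 1:] ^ N)"
    by (rule prod_dvd_prod_subset) (auto simp: S_def)
  finally have "map_poly to_ac p dvd (\<Prod>a\<in>S. [:-a, 1:] ^ N)"
    by (subst A) (intro smult_dvd, use \<open>map_poly to_ac p \<noteq> 0\<close> in auto)
  moreover have "finite S" "0 \<in> S" "N > 0" by (simp_all add: S_def N_def)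
  ultimately show ?thesis using p(2) by blast
qed

text \<open>Here \<open>m a\<close> is the multiplicity of the eigenvalue \<open>a\<close>, obtained as the trace of the projection to
  its generalised eigenspace; it is a natural number because the projection is idempotent.\<close>

lemma trace_poly_spectral:
  assumes f: "endo f"
    and S: "finite S" "0 \<in> S" "N > 0"
    and p: "\<And>v. poly_endo f p v = 0" "map_poly to_ac p dvd (\<Prod>a\<in>S. [:-a, 1:] ^ N)"
  shows "\<exists>m :: 'a alg_closure \<Rightarrow> nat.
    (\<forall>q g. (\<forall>a\<in>S. [:-a, 1:] ^ N dvd q - [:g a:]) \<longrightarrow>
      trace_poly f q = (\<Sum>a\<in>S. g a * of_nat (m a)) \<and>
      trace_poly f (pCons 0 q) = (\<Sum>a\<in>S. a * g a * of_nat (m a))) \<and>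
    ((\<forall>a\<in>S. a \<noteq> 0 \<longrightarrow> m a = 0) \<longrightarrow> (\<forall>v. (f ^^ N) v = 0))"
proof -
  have mat0: "mat_poly f q i j = 0" if "\<And>a. a \<in> S \<Longrightarrow> [:-a, 1:] ^ N dvd q" for q i j
  proof -
    have "(\<Prod>a\<in>S. [:-a, 1:] ^ N) dvd q"
      using S(1) that by (rule prod_dvd_of_comaximal) (auto intro: comaximal_powers comaximal_linear)
    with p(2) have "map_poly to_ac p dvd q" by (rule dvd_trans)
    then obtain r where "q = map_poly to_ac p * r" by (rule dvdE)
    then show ?thesis
      by (simp add: mat_poly_mult[OF f] mat_poly_annihilated[OF p(1)] mat_mult_def)
  qed
  \<comment> \<open>These polynomials represent the projections to the generalised eigenspaces: 1
    modulo the factor at \<open>a\<close>, 0 modulo the others.\<close>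
  have "\<exists>e. \<forall>b\<in>S. [:-b, 1:] ^ N dvd e - [:if b = a then 1 else 0:]" for a
    by (rule chinese_remainder_poly[OF S(1)])
  then obtain e where e: "\<And>a b. b \<in> S \<Longrightarrow> [:-b, 1:] ^ N dvd e a - [:if b = a then 1 else 0:]"
    by metis
  have e_neq: "[:-b, 1:] ^ N dvd e a" if "b \<in> S" "b \<noteq> a" for a b
    using e[OF that(1), of a] that(2) by simp
  have e_eq: "[:-a, 1:] ^ N dvd e a - 1" if "a \<in> S" for a
    using e[OF that, of a] by (simp flip: one_pCons)
  have idem: "mat_mult Basis (mat_poly f (e a)) (mat_poly f (e a)) i j = mat_poly f (e a) i j"
    if "a \<in> S" for a i j
  proof -
    have "mat_poly f (e a * e a - e a) i j = 0"
    proof (rule mat0)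
      fix b assume b: "b \<in> S"
      have "e a * e a - e a = e a * (e a - 1)" by (simp add: algebra_simps)
      then show "[:-b, 1:] ^ N dvd e a * e a - e a"
        using e_eq e_neq b by (cases "b = a") auto
    qed
    then show ?thesis by (simp add: mat_poly_diff mat_poly_mult[OF f])
  qed
  have "\<exists>r::nat. (\<Sum>i\<in>Basis. mat_poly f (e a) i i) = of_nat r \<and>
      (r = 0 \<longrightarrow> (\<forall>i\<in>Basis. \<forall>j\<in>Basis. mat_poly f (e a) i j = 0))" if a: "a \<in> S" for a
  proof (rule trace_idempotent_matrix[OF finite_Basis idem[OF a]])
    fix r :: nat
    assume "(\<Sum>i\<in>Basis. mat_poly f (e a) i i) = of_nat r"
      "r = 0 \<Longrightarrow> \<forall>i\<in>Basis. \<forall>j\<in>Basis. mat_poly f (e a) i j = 0"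
    then show ?thesis by blast
  qed
  then obtain m :: "'a alg_closure \<Rightarrow> nat" where
    m: "\<And>a. a \<in> S \<Longrightarrow> trace_poly f (e a) = of_nat (m a)" and
    m0: "\<And>a i j. a \<in> S \<Longrightarrow> m a = 0 \<Longrightarrow> i \<in> Basis \<Longrightarrow> j \<in> Basis \<Longrightarrow> mat_poly f (e a) i j = 0"
    unfolding trace_poly_def by metis
  \<comment> \<open>\<open>q\<close> agrees with the combination of the \<open>e a\<close> modulo
    every local factor; the multiplier \<open>r\<close> will be 1, X or a power of X.\<close>
  have expand: "[:-b, 1:] ^ N dvd r * q - (\<Sum>a\<in>S. smult (g a) (r * e a))"
    if q: "\<And>a. a \<in> S \<Longrightarrow> [:-a, 1:] ^ N dvd q - [:g a:]" and b: "b \<in> S" for q g b r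
  proof -
    have "[:-b, 1:] ^ N dvd (\<Sum>a\<in>S - {b}. smult (g a) (r * e a))"
      using e_neq b by (intro dvd_sum dvd_smult dvd_mult) auto
    moreover have "(\<Sum>a\<in>S. smult (g a) (r * e a))
        = smult (g b) (r * e b) + (\<Sum>a\<in>S - {b}. smult (g a) (r * e a))"
      using S(1) b by (rule sum.remove)
    moreover have "[:-b, 1:] ^ N dvd r * ((q - [:g b:]) - smult (g b) (e b - 1))"
      by (rule dvd_mult[OF dvd_diff[OF q[OF b] dvd_smult[OF e_eq[OF b]]]])
    moreover have "r * ((q - [:g b:]) - smult (g b) (e b - 1)) = r * q - smult (g b) (r * e b)"
      by (simp add: algebra_simps smult_diff_right)
    ultimately show ?thesis by (simp only: diff_diff_eq[symmetric] dvd_diff)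
  qed
  have trace_0: "trace_poly f q = 0" if "\<And>a. a \<in> S \<Longrightarrow> [:-a, 1:] ^ N dvd q" for q
    using mat0[OF that] by (simp add: trace_poly_def)
  have trace_mult: "trace_poly f (r * q) = (\<Sum>a\<in>S. g a * trace_poly f (r * e a))"
    if q: "\<And>a. a \<in> S \<Longrightarrow> [:-a, 1:] ^ N dvd q - [:g a:]" for q g r
  proof -
    have "trace_poly f (r * q - (\<Sum>a\<in>S. smult (g a) (r * e a))) = 0"
      by (rule trace_0, rule expand[OF q])
    then show ?thesis
      by (simp add: trace_poly_diff trace_poly_sum trace_poly_smult)
  qed
  have trace_X: "trace_poly f ([:0, 1:] * e a) = a * of_nat (m a)" if a: "a \<in> S" for a
  proof -
    \<comment> \<open>On its generalised eigenspace \<open>f\<close> minus \<open>a\<close> is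
      nilpotent, so it contributes no trace. The index \<open>N - 1\<close> below encodes the N-th
      power.\<close>
    have "trace_poly f ([:-a, 1:] * e a) = 0"
      unfolding trace_poly_def
    proof (rule trace_nilpotent_matrix[OF finite_Basis, of "mat_poly f ([:-a, 1:] * e a)" "N - 1"])
      fix i j
      have "mat_poly f (([:-a, 1:] * e a) ^ N) i j = 0"
      proof (rule mat0)
        fix b assume b: "b \<in> S"
        show "[:-b, 1:] ^ N dvd ([:-a, 1:] * e a) ^ N"
        proof (cases "b = a")
          case False
          then have "[:-b, 1:] ^ N dvd [:-a, 1:] * e a" using e_neq b by (intro dvd_mult) auto
          then show ?thesis using S(3) by (meson dvd_power dvd_trans)
        next
          case True
          then show ?thesis unfolding power_mult_distrib by simp
        qed
      qed
      then show "mat_pow Basis (mat_poly f ([:-a, 1:] * e a)) (N - 1) i j = 0"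
        using mat_poly_power[OF f, of "[:-a, 1:] * e a" "N - 1"] S(3) by simp
    qed
    moreover have "[:0, 1:] * e a = [:-a, 1:] * e a + smult a (e a)" by simp
    ultimately show ?thesis by (simp only: trace_poly_add trace_poly_smult m[OF a]) simp
  qed
  show ?thesis
  proof (intro exI[of _ m] conjI allI impI)
    fix q g assume "\<forall>a\<in>S. [:-a, 1:] ^ N dvd q - [:g a:]"
    then have q: "\<And>a. a \<in> S \<Longrightarrow> [:-a, 1:] ^ N dvd q - [:g a:]" by blast
    show "trace_poly f q = (\<Sum>a\<in>S. g a * of_nat (m a))"
      using trace_mult[OF q, of 1] m by simp
    show "trace_poly f (pCons 0 q) = (\<Sum>a\<in>S. a * g a * of_nat (m a))"
      using trace_mult[OF q, of "[:0, 1:]"] trace_X by (simp add: mult_ac)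
  next
    fix v assume "\<forall>a\<in>S. a \<noteq> 0 \<longrightarrow> m a = 0"
    then have m_0: "\<And>a. a \<in> S \<Longrightarrow> a \<noteq> 0 \<Longrightarrow> m a = 0" by blast
    let ?X = "[:0, 1:] ^ N :: 'a alg_closure poly"
    have "mat_poly f ?X i j = 0" if ij: "i \<in> Basis" "j \<in> Basis" for i j
    proof -
      \<comment> \<open>\<open>?X\<close> decomposes along the projections: for \<open>a = 0\<close>
        its part is divisible by every local factor, for other \<open>a\<close> the projection
        vanishes because its trace \<open>m a\<close> is 0.\<close>
      have "mat_poly f (?X * 1 - (\<Sum>a\<in>S. smult 1 (?X * e a))) i j = 0"
        by (rule mat0, rule expand) (simp_all flip: one_pCons)
      then have "mat_poly f ?X i j = (\<Sum>a\<in>S. mat_poly f (?X * e a) i j)"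
        by (simp add: mat_poly_diff mat_poly_sum)
      also have "\<dots> = 0"
      proof (rule sum.neutral, rule ballI)
        fix a assume a: "a \<in> S"
        show "mat_poly f (?X * e a) i j = 0"
        proof (cases "a = 0")
          case True
          show ?thesis
          proof (rule mat0)
            fix b assume "b \<in> S"
            then show "[:-b, 1:] ^ N dvd ?X * e a" using e_neq[of b a] True by (cases "b = 0") auto
          qed
        next
          case False
          then show ?thesis
            using m0[OF a m_0[OF a False]] ij by (simp add: mat_poly_mult[OF f] mat_mult_def)
        qed
      qed
      finally show ?thesis .
    qed
    moreover have "mat_poly f ?X i j = to_ac (representation Basis ((f ^^ N) j) i)" for i j
    proof -
      have "?X = monom 1 N" by (simp add: monom_altdef)
      then show ?thesis
        by (simp add: mat_poly_def umbral_sum_def degree_monom_eq if_distrib[of "\<lambda>c. c * _"] cong: if_cong)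
    qed
    ultimately show "(f ^^ N) v = 0"
      by (intro endo_eq_0[OF endo_funpow[OF f]]) simp
  qed
qed

text \<open>For \<open>a\<close> in \<open>S\<close> other than 0, the projection polynomial has no
  constant term, as it vanishes at 0. Its trace combines traces of positive powers and so is 0, but
  it also equals \<open>m a\<close>.\<close>

lemma nilpotent_of_trace_powers:
  assumes f: "endo f" and tr: "\<And>k. k > 0 \<Longrightarrow> endo_trace (f ^^ k) = 0"
  shows "\<exists>n. \<forall>v. (f ^^ n) v = 0"
proof -
  obtain S N p where S: "finite S" "0 \<in> S" "N > 0"
    and p: "\<And>v. poly_endo f p v = 0" "map_poly to_ac p dvd (\<Prod>a\<in>S. [:-a, 1:] ^ N)"
    using exists_split_annihilating_poly[OF f] by blast
  obtain m :: "'a alg_closure \<Rightarrow> nat" where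
    m: "\<And>q g. (\<forall>a\<in>S. [:-a, 1:] ^ N dvd q - [:g a:]) \<Longrightarrow>
      trace_poly f q = (\<Sum>a\<in>S. g a * of_nat (m a))"
    and nil: "(\<forall>a\<in>S. a \<noteq> 0 \<longrightarrow> m a = 0) \<Longrightarrow> (\<forall>v. (f ^^ N) v = 0)"
    using trace_poly_spectral[OF f S p] by blast
  have "m a = 0" if a: "a \<in> S" "a \<noteq> 0" for a
  proof -
    obtain q where q: "\<forall>b\<in>S. [:-b, 1:] ^ N dvd q - [:if b = a then 1 else 0:]"
      using chinese_remainder_poly[OF S(1), of N "\<lambda>b. if b = a then 1 else 0"] by blast
    have "[:-0, 1:] ^ N dvd q" using q S(2) a by force
    then have "[:-0, 1:] dvd q" using S(3) by (meson dvd_power dvd_trans)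
    then have "coeff q 0 = 0" by (auto elim!: dvdE)
    then have "trace_poly f q = 0"
      unfolding trace_poly_altdef umbral_sum_def
      by (intro sum.neutral ballI) (metis gr0I mult_eq_0_iff to_ac_0 tr)
    moreover have "trace_poly f q = of_nat (m a)"
      using m[OF q] a(1) S(1) by (simp add: if_distrib[of "\<lambda>c. c * _"] cong: if_cong)
    ultimately show ?thesis by simp
  qed
  then show ?thesis using nil by blast
qed

end

section \<open>Replicas of an endomorphism\<close>

text \<open>Applied twice to the algebraic closure, which may be infinite-dimensional: over the
  rationals it yields \<open>\<phi>\<close>, over the ground field \<open>\<psi>\<close>.\<close>

lemma (in vector_space) exists_linear_functional:
  assumes "x \<noteq> 0"
  shows "\<exists>\<phi>. (\<forall>u v. \<phi> (u + v) = \<phi> u + \<phi> v) \<and> (\<forall>c v. \<phi> (scale c v) = c * \<phi> v) \<and> \<phi> x = 1"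
proof -
  have ind: "independent {x}" using assms by simp
  define B where "B = extend_basis {x}"
  have B: "independent B" "span B = UNIV" "x \<in> B"
    unfolding B_def
    using independent_extend_basis[OF ind] span_extend_basis[OF ind] extend_basis_superset[OF ind]
    by auto
  show ?thesis
    by (rule exI[of _ "\<lambda>v. representation B v x"])
      (use B in \<open>simp_all add: representation_add representation_scale representation_basis\<close>)
qed

context finite_dimensional_vector_space_char_0
begin

lemma endo_sum: "(\<And>i. i \<in> A \<Longrightarrow> endo (h i)) \<Longrightarrow> endo (\<lambda>v. \<Sum>i\<in>A. h i v)"
  by (induction A rule: infinite_finite_induct) (auto intro: endo_zero endo_add)

text \<open>The variable \<open>u\<close> acts on \<open>Z\<close> by composition with \<open>f\<close> on the left, \<open>v\<close> by composition on the
  right, so \<open>u - v\<close> acts as \<open>ad f\<close>; the functional \<open>\<psi>\<close> brings the coefficients back to the ground field.\<close>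

definition poly_endo2 ::
    "('a alg_closure \<Rightarrow> 'a) \<Rightarrow> ('b \<Rightarrow> 'b) \<Rightarrow> ('b \<Rightarrow> 'b) \<Rightarrow> 'a alg_closure poly poly \<Rightarrow> 'b \<Rightarrow> 'b"
  where "poly_endo2 \<psi> f Z G v =
    umbral_sum (\<lambda>i c. umbral_sum (\<lambda>j d. scale (\<psi> d) ((f ^^ i) (Z ((f ^^ j) v)))) c) G"

context
  fixes \<psi> :: "'a alg_closure \<Rightarrow> 'a" and f Z
  assumes \<psi>_add: "\<And>x y. \<psi> (x + y) = \<psi> x + \<psi> y"
    and \<psi>_scale: "\<And>c x. \<psi> (to_ac c * x) = c * \<psi> x"
    and f: "endo f" and Z: "endo Z"
begin

interpretation f: Vector_Spaces.linear scale scale f by (rule f)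

lemma \<psi>_0: "\<psi> 0 = 0"
  using \<psi>_scale[of 0 0] by simp

abbreviation (input) "\<Phi> \<equiv> poly_endo2 \<psi> f Z"

lemma poly_endo2_add: "\<Phi> (G + H) v = \<Phi> G v + \<Phi> H v"
  unfolding poly_endo2_def
  by (simp add: umbral_sum_add \<psi>_0 \<psi>_add scale_left_distrib)

lemma poly_endo2_0: "\<Phi> 0 v = 0"
  by (simp add: poly_endo2_def \<psi>_0)

lemma poly_endo2_diff: "\<Phi> (G - H) v = \<Phi> G v - \<Phi> H v"
  using poly_endo2_add[of "G - H" H v] by simp

lemma poly_endo2_u: "\<Phi> (var_u * G) = (\<lambda>v. f (\<Phi> G v))"
proof
  fix v
  have "\<Phi> (var_u * G) v = umbral_sum (\<lambda>i c. umbral_sum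
      (\<lambda>j d. scale (\<psi> d) ((f ^^ Suc i) (Z ((f ^^ j) v)))) c) G"
    unfolding poly_endo2_def by (simp add: umbral_sum_pCons \<psi>_0)
  then show "\<Phi> (var_u * G) v = f (\<Phi> G v)"
    unfolding poly_endo2_def by (simp add: umbral_sum_def f.sum f.scale)
qed

lemma poly_endo2_v: "\<Phi> (var_v * G) = (\<lambda>v. \<Phi> G (f v))"
proof
  fix v
  have "\<Phi> (var_v * G) v = umbral_sum (\<lambda>i c. umbral_sum
      (\<lambda>j d. scale (\<psi> d) ((f ^^ i) (Z ((f ^^ j) v)))) ([:0, 1:] * c)) G"
    unfolding poly_endo2_def by (simp add: umbral_sum_smult \<psi>_0)
  then show "\<Phi> (var_v * G) v = \<Phi> G (f v)"
    unfolding poly_endo2_def by (simp add: umbral_sum_pCons \<psi>_0 funpow_swap1)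
qed

lemma poly_endo2_scale: "\<Phi> ([:[:to_ac k:]:] * G) v = scale k (\<Phi> G v)"
proof -
  have "\<Phi> ([:[:to_ac k:]:] * G) v = umbral_sum (\<lambda>i c. umbral_sum
      (\<lambda>j d. scale (\<psi> d) ((f ^^ i) (Z ((f ^^ j) v)))) ([:to_ac k:] * c)) G"
    unfolding poly_endo2_def by (simp add: umbral_sum_smult \<psi>_0)
  also have "\<dots> = umbral_sum (\<lambda>i c. umbral_sum
      (\<lambda>j d. scale (k * \<psi> d) ((f ^^ i) (Z ((f ^^ j) v)))) c) G"
    by (simp add: umbral_sum_smult \<psi>_0 \<psi>_scale)
  finally show ?thesis
    unfolding poly_endo2_def by (simp add: umbral_sum_def scale_sum_right)
qed

lemma poly_endo2_const: "\<Phi> [:[:c:]:] v = scale (\<psi> c) (Z v)"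
  unfolding poly_endo2_def by (simp add: umbral_sum_pCons \<psi>_0)

lemma endo_poly_endo2: "endo (\<Phi> G)"
  unfolding poly_endo2_def[abs_def] umbral_sum_def
  by (intro endo_sum endo_compose[OF endo_scale] endo_compose[OF endo_funpow[OF f]]
      endo_compose[OF Z] endo_funpow[OF f])

lemma poly_endo2_poly_at:
  assumes w: "\<And>G. \<Phi> (w * G) = T (\<Phi> G)"
    and T_scale: "\<And>c Y. T (\<lambda>v. scale c (Y v)) = (\<lambda>v. scale c (T Y v))"
  shows "\<Phi> (poly_at q w) v = umbral_sum (\<lambda>k c. scale (\<psi> c) ((T ^^ k) Z v)) q"
proof -
  have const: "\<Phi> (w ^ n * [:[:c:]:]) = (\<lambda>v. scale (\<psi> c) ((T ^^ n) Z v))" for n c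
  proof (induction n)
    case 0
    show ?case using poly_endo2_const by (auto simp del: mult_pCons_right)
  next
    case (Suc n)
    then show ?case using w[of "w ^ n * [:[:c:]:]"] T_scale by (simp only: power_Suc mult.assoc) simp
  qed
  have "\<Phi> (w ^ n * poly_at q w) v = umbral_sum (\<lambda>k c. scale (\<psi> c) ((T ^^ (n + k)) Z v)) q" for n
  proof (induction q arbitrary: n)
    case 0
    show ?case by (simp add: poly_endo2_0 \<psi>_0)
  next
    case (pCons a q)
    have "w ^ n * poly_at (pCons a q) w = w ^ n * [:[:a:]:] + w ^ Suc n * poly_at q w"
      by (simp only: poly_at_pCons distrib_left power_Suc mult_ac)
    then show ?case
      by (simp only: poly_endo2_add const pCons.IH) (simp add: umbral_sum_pCons \<psi>_0)
  qed
  from this[of 0] show ?thesis by simp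
qed

lemma poly_endo2_poly_at_mult:
  assumes w: "\<And>G. \<Phi> (w * G) = T (\<Phi> G)"
  shows "\<Phi> (poly_at (map_poly to_ac p) w * G) v = umbral_sum (\<lambda>k c. scale c ((T ^^ k) (\<Phi> G) v)) p"
proof (induction p arbitrary: G)
  case 0
  show ?case by (simp add: poly_endo2_0)
next
  case (pCons a p)
  have "poly_at (map_poly to_ac (pCons a p)) w * G
      = [:[:to_ac a:]:] * G + poly_at (map_poly to_ac p) w * (w * G)"
    by (simp only: map_poly_pCons[of to_ac, OF to_ac_0] poly_at_pCons) (simp only: algebra_simps)
  then show ?case
    by (simp only: poly_endo2_add poly_endo2_scale pCons.IH w)
      (simp add: umbral_sum_pCons funpow_swap1)
qed

text \<open>In the variable \<open>u\<close> the polynomial \<open>p\<close> acts as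
  \<open>p(f)\<close> after the map, in \<open>v\<close> as \<open>p(f)\<close> before it, and both
  vanish.\<close>

lemma poly_endo2_ideal:
  assumes p: "\<And>v. poly_endo f p v = 0"
    and D: "in_ideal2 (poly_at (map_poly to_ac p) var_u) (poly_at (map_poly to_ac p) var_v) D"
  shows "\<Phi> D v = 0"
proof -
  obtain G H where D: "D = poly_at (map_poly to_ac p) var_u * G + poly_at (map_poly to_ac p) var_v * H"
    using D unfolding in_ideal2_def by blast
  have "((\<lambda>Y v. f (Y v)) ^^ k) Y v = (f ^^ k) (Y v)" for k and Y :: "'b \<Rightarrow> 'b" and v
    by (induction k arbitrary: v) simp_all
  then have 1: "\<Phi> (poly_at (map_poly to_ac p) var_u * G) v = poly_endo f p (\<Phi> G v)"
    using poly_endo2_poly_at_mult[OF poly_endo2_u] by (simp add: poly_endo_def)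
  interpret H: Vector_Spaces.linear scale scale "\<Phi> H" by (rule endo_poly_endo2)
  have "((\<lambda>Y v. Y (f v)) ^^ k) Y v = Y ((f ^^ k) v)" for k and Y :: "'b \<Rightarrow> 'b" and v
    by (induction k arbitrary: v) (simp_all add: funpow_swap1)
  then have 2: "\<Phi> (poly_at (map_poly to_ac p) var_v * H) v = \<Phi> H (poly_endo f p v)"
    using poly_endo2_poly_at_mult[OF poly_endo2_v]
    by (simp add: poly_endo_def umbral_sum_def H.sum H.scale)
  show ?thesis unfolding D poly_endo2_add 1 2 p by (rule H.zero[THEN trans[rotated]]) simp
qed

text \<open>When the left side vanishes, this says that \<open>ad q'(f)\<close> and
  \<open>r'(ad f)\<close> agree on \<open>Z\<close>, where q' and r' arise from \<open>q\<close> and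
  \<open>r\<close> by applying \<open>\<psi>\<close> to the coefficients.\<close>

lemma poly_endo2_replica:
  "\<Phi> (poly_at q var_u - poly_at q var_v - poly_at r (var_u - var_v)) v =
    poly_endo f (map_poly \<psi> q) (Z v) - Z (poly_endo f (map_poly \<psi> q) v)
    - umbral_sum (\<lambda>k c. scale c (((\<lambda>Y w. f (Y w) - Y (f w)) ^^ k) Z v)) (map_poly \<psi> r)"
proof -
  interpret Z: Vector_Spaces.linear scale scale Z by (rule Z)
  have "((\<lambda>Y v. f (Y v)) ^^ k) Y v = (f ^^ k) (Y v)" for k and Y :: "'b \<Rightarrow> 'b" and v
    by (induction k arbitrary: v) simp_all
  then have 1: "\<Phi> (poly_at q var_u) v = poly_endo f (map_poly \<psi> q) (Z v)"
    using poly_endo2_poly_at[OF poly_endo2_u]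
    by (simp add: poly_endo_def f.scale umbral_sum_map_poly \<psi>_0)
  have "((\<lambda>Y v. Y (f v)) ^^ k) Y v = Y ((f ^^ k) v)" for k and Y :: "'b \<Rightarrow> 'b" and v
    by (induction k arbitrary: v) (simp_all add: funpow_swap1)
  then have 2: "\<Phi> (poly_at q var_v) v = Z (poly_endo f (map_poly \<psi> q) v)"
    using poly_endo2_poly_at[OF poly_endo2_v]
    by (simp add: poly_endo_def umbral_sum_map_poly \<psi>_0) (simp add: umbral_sum_def Z.sum Z.scale)
  have "\<Phi> ((var_u - var_v) * G) = (\<lambda>w. f (\<Phi> G w) - \<Phi> G (f w))" for G
    by (rule ext) (simp only: left_diff_distrib poly_endo2_diff poly_endo2_u poly_endo2_v)
  then have 3: "\<Phi> (poly_at r (var_u - var_v)) v =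
      umbral_sum (\<lambda>k c. scale c (((\<lambda>Y w. f (Y w) - Y (f w)) ^^ k) Z v)) (map_poly \<psi> r)"
    by (subst poly_endo2_poly_at[of _ "\<lambda>Y w. f (Y w) - Y (f w)"])
      (simp_all add: f.scale scale_right_diff_distrib umbral_sum_map_poly \<psi>_0)
  show ?thesis by (simp only: poly_endo2_diff 1 2 3)
qed

end

text \<open>The hypothesis concerns only replicas over the ground field; a replica over the closure
  is therefore tested through its images under functionals \<open>\<psi>\<close>.\<close>

lemma nilpotent_of_trace_replicas:
  assumes f: "endo f"
    and replica: "\<And>q r. coeff r 0 = 0 \<Longrightarrow>
      (\<And>Z v. endo Z \<Longrightarrow> poly_endo f q (Z v) - Z (poly_endo f q v)
        = umbral_sum (\<lambda>k c. scale c (((\<lambda>Y w. f (Y w) - Y (f w)) ^^ k) Z v)) r) \<Longrightarrow>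
      endo_trace (\<lambda>v. f (poly_endo f q v)) = 0"
  shows "\<exists>n. \<forall>v. (f ^^ n) v = 0"
proof -
  obtain S N p where S: "finite S" "0 \<in> S" "N > 0"
    and p: "\<And>v. poly_endo f p v = 0" "map_poly to_ac p dvd (\<Prod>a\<in>S. [:-a, 1:] ^ N)"
    using exists_split_annihilating_poly[OF f] by blast
  obtain m :: "'a alg_closure \<Rightarrow> nat" where
    m: "\<And>q g. (\<forall>a\<in>S. [:-a, 1:] ^ N dvd q - [:g a:]) \<Longrightarrow>
      trace_poly f (pCons 0 q) = (\<Sum>a\<in>S. a * g a * of_nat (m a))"
    and nil: "(\<forall>a\<in>S. a \<noteq> 0 \<longrightarrow> m a = 0) \<Longrightarrow> (\<forall>v. (f ^^ N) v = 0)"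
    using trace_poly_spectral[OF f S p] by blast
  have "m a = 0" if a: "a \<in> S" "a \<noteq> 0" for a
  proof -
    \<comment> \<open>Rational values are chosen for \<open>\<phi>\<close> because they are ordered,
      so that a sum of squares can be shown to vanish only termwise.\<close>
    interpret Q: vector_space "\<lambda>r (x :: 'a alg_closure). of_rat r * x"
      by unfold_locales (simp_all add: algebra_simps of_rat_add of_rat_mult)
    obtain \<phi> :: "'a alg_closure \<Rightarrow> rat" where \<phi>: "\<And>x y. \<phi> (x + y) = \<phi> x + \<phi> y"
      "\<And>r x. \<phi> (of_rat r * x) = r * \<phi> x" "\<phi> a = 1"
      using Q.exists_linear_functional[OF a(2)] by blast
    have \<phi>_diff: "\<phi> (x - y) = \<phi> x - \<phi> y" for x y
      using \<phi>(1)[of "x - y" y] by simp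
    have \<phi>_0: "\<phi> 0 = 0" using \<phi>_diff[of 0 0] by simp
    define g :: "'a alg_closure \<Rightarrow> 'a alg_closure" where "g = (\<lambda>x. of_rat (\<phi> x))"
    have g_diff: "g (x - y) = g x - g y" for x y by (simp add: g_def \<phi>_diff of_rat_diff)
    obtain q where q: "\<forall>b\<in>S. [:-b, 1:] ^ N dvd q - [:g b:]"
      using chinese_remainder_poly[OF S(1)] by blast
    \<comment> \<open>\<open>r\<close> interpolates \<open>g\<close> at the differences of points of
      \<open>S\<close>, where the eigenvalues of \<open>ad f\<close> lie; additivity of
      \<open>g\<close> turns its value there into \<open>g b - g c\<close>.\<close>
    have "finite ((\<lambda>(b, c). b - c) ` (S \<times> S))" using S(1) by simp
    from chinese_remainder_poly[OF this, of "N + N" g]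
    obtain r where r: "\<And>b c. b \<in> S \<Longrightarrow> c \<in> S \<Longrightarrow> [:-(b - c), 1:] ^ (N + N) dvd r - [:g (b - c):]"
      by force
    have "[:-0, 1:] ^ (N + N) dvd r" using r[OF S(2) S(2)] by (simp add: g_def \<phi>_0)
    then have "[:-0, 1:] dvd r" using S(3) by (meson add_pos_pos dvd_power dvd_trans)
    then have r0: "coeff r 0 = 0" by auto
    have "in_ideal2 (poly_at (\<Prod>a\<in>S. [:-a, 1:] ^ N) var_u) (poly_at (\<Prod>a\<in>S. [:-a, 1:] ^ N) var_v)
        (poly_at q var_u - poly_at q var_v - poly_at r (var_u - var_v))"
      by (rule in_ideal2_poly_at_diff[OF S(1), of _ _ g]) (use q r in \<open>auto simp: g_diff\<close>)
    moreover obtain h where "(\<Prod>a\<in>S. [:-a, 1:] ^ N) = map_poly to_ac p * h" using p(2) by (rule dvdE)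
    ultimately have "in_ideal2 (poly_at (map_poly to_ac p) var_u * poly_at h var_u)
        (poly_at (map_poly to_ac p) var_v * poly_at h var_v)
        (poly_at q var_u - poly_at q var_v - poly_at r (var_u - var_v))"
      by (simp only: poly_at_mult)
    then have ideal: "in_ideal2 (poly_at (map_poly to_ac p) var_u) (poly_at (map_poly to_ac p) var_v)
        (poly_at q var_u - poly_at q var_v - poly_at r (var_u - var_v))"
      by (rule in_ideal2_of_multiples)
    have "trace_poly f (pCons 0 q) = 0"
    proof (rule ccontr)
      \<comment> \<open>A nonzero trace is detected by some \<open>\<psi>\<close>; applying
        \<open>\<psi>\<close> to the coefficients of \<open>q\<close> and \<open>r\<close> gives a
        pair over the ground field to which \<open>replica\<close> applies.\<close>
      assume nz: "trace_poly f (pCons 0 q) \<noteq> 0"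
      interpret K: vector_space "\<lambda>k (x :: 'a alg_closure). to_ac k * x"
        by unfold_locales (simp_all add: algebra_simps)
      obtain \<psi> :: "'a alg_closure \<Rightarrow> 'a" where \<psi>: "\<And>x y. \<psi> (x + y) = \<psi> x + \<psi> y"
        "\<And>k x. \<psi> (to_ac k * x) = k * \<psi> x" "\<psi> (trace_poly f (pCons 0 q)) = 1"
        using K.exists_linear_functional[OF nz] by blast
      have \<psi>0: "\<psi> 0 = 0" using \<psi>(2)[of 0 0] by simp
      have "endo_trace (\<lambda>v. f (poly_endo f (map_poly \<psi> q) v)) = 0"
      proof (rule replica[of "map_poly \<psi> r"])
        show "coeff (map_poly \<psi> r) 0 = 0" by (simp add: coeff_map_poly \<psi>0 r0)
        fix Z v assume Z: "endo Z"
        show "poly_endo f (map_poly \<psi> q) (Z v) - Z (poly_endo f (map_poly \<psi> q) v)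
          = umbral_sum (\<lambda>k c. scale c (((\<lambda>Y w. f (Y w) - Y (f w)) ^^ k) Z v)) (map_poly \<psi> r)"
          using poly_endo2_ideal[OF \<psi>(1,2) f Z p(1) ideal, of v]
            poly_endo2_replica[OF \<psi>(1,2) f Z, of q r v] by simp
      qed
      moreover have "endo_trace (\<lambda>v. f (poly_endo f (map_poly \<psi> q) v)) = \<psi> (trace_poly f (pCons 0 q))"
      proof -
        interpret f: Vector_Spaces.linear scale scale f by (rule f)
        have tr_sum: "endo_trace (\<lambda>v. \<Sum>i\<in>A. h i v) = (\<Sum>i\<in>A. endo_trace (h i))"
          for A :: "nat set" and h
          by (induction A rule: infinite_finite_induct) (simp_all add: endo_trace_add)
        have "(\<lambda>v. f (poly_endo f (map_poly \<psi> q) v))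
            = (\<lambda>v. \<Sum>k\<le>degree q. scale (\<psi> (coeff q k)) ((f ^^ Suc k) v))"
          by (simp add: poly_endo_def umbral_sum_map_poly \<psi>0) (simp add: umbral_sum_def f.sum f.scale)
        then have "endo_trace (\<lambda>v. f (poly_endo f (map_poly \<psi> q) v))
            = (\<Sum>k\<le>degree q. endo_trace (f ^^ Suc k) * \<psi> (coeff q k))"
          by (simp only: tr_sum endo_trace_scale mult.commute)
        moreover have "\<psi> (trace_poly f (pCons 0 q))
            = umbral_sum (\<lambda>k c. \<psi> (to_ac (endo_trace (f ^^ Suc k)) * c)) q"
          unfolding trace_poly_altdef
          by (subst umbral_sum_pCons) (simp_all add: umbral_sum_hom[of \<psi>, OF \<psi>0 \<psi>(1)] mult.commute)
        ultimately show ?thesis by (simp add: \<psi>(2) umbral_sum_def)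
      qed
      ultimately show False using \<psi>(3) by simp
    qed
    \<comment> \<open>Under \<open>\<phi>\<close> each summand becomes a square times a
      multiplicity; all these are nonnegative with sum 0, and \<open>\<phi> a = 1\<close>.\<close>
    then have "0 = \<phi> (\<Sum>b\<in>S. b * g b * of_nat (m b))"
      using m[OF q] \<phi>_0 by simp
    also have "\<dots> = (\<Sum>b\<in>S. \<phi> (b * g b * of_nat (m b)))"
      using sum_comp_morphism[of \<phi> "\<lambda>b. b * g b * of_nat (m b)" S] \<phi>_0 \<phi>(1) by (simp add: comp_def)
    also have "\<dots> = (\<Sum>b\<in>S. (\<phi> b)\<^sup>2 * of_nat (m b))"
    proof (rule sum.cong)
      fix b
      have "b * g b * of_nat (m b) = of_rat (\<phi> b * of_nat (m b)) * b"
        by (simp add: g_def of_rat_mult)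
      then show "\<phi> (b * g b * of_nat (m b)) = (\<phi> b)\<^sup>2 * of_nat (m b)"
        by (simp only: \<phi>(2)) (simp add: power2_eq_square)
    qed simp
    finally have "(\<phi> a)\<^sup>2 * of_nat (m a) = 0"
      using sum_nonneg_eq_0_iff[OF S(1), of "\<lambda>b. (\<phi> b)\<^sup>2 * of_nat (m b)"] a(1) by simp
    then show ?thesis using \<phi>(3) by simp
  qed
  then show ?thesis using nil by blast
qed

end

section \<open>Leibniz algebras\<close>

no_notation Module.module.smult (infixl "\<odot>\<index>" 70)

context left_leibniz_algebra
begin

lemma mult_add_right: "x \<odot> (y + z) = x \<odot> y + x \<odot> z"
  and mult_scale_right: "x \<odot> scale c y = scale c (x \<odot> y)"
  and mult_add_left: "(y + z) \<odot> x = y \<odot> x + z \<odot> x"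
  and mult_scale_left: "scale c y \<odot> x = scale c (y \<odot> x)"
  using linear_mult_right[of x] linear_mult_left[of x] by (auto simp: Vector_Spaces.linear_iff)

lemma mult_0_right [simp]: "x \<odot> 0 = 0" and mult_0_left [simp]: "0 \<odot> x = 0"
  using mult_scale_right[of x 0 0] mult_scale_left[of 0 0 x] by simp_all

lemma mult_minus_right: "x \<odot> (- y) = - (x \<odot> y)"
  using mult_add_right[of x y "- y"] by (simp add: eq_neg_iff_add_eq_0 add.commute)

lemma mult_diff_right: "x \<odot> (y - z) = x \<odot> y - x \<odot> z"
  using mult_add_right[of x y "- z"] by (simp add: mult_minus_right)

lemma mult_mult_left: "(x \<odot> y) \<odot> z = x \<odot> (y \<odot> z) - y \<odot> (x \<odot> z)"
  using left_leibniz[of x y z] by simp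

lemma subspace_vimage_right: "subspace C \<Longrightarrow> subspace {y. x \<odot> y \<in> C}"
  and subspace_vimage_left: "subspace C \<Longrightarrow> subspace {y. y \<odot> x \<in> C}"
  by (auto simp: subspace_def mult_add_right mult_scale_right mult_add_left mult_scale_left)

lemma subspace_product_space: "subspace (product_space A B)"
  by (simp add: product_space_def)

lemma product_spaceI: "a \<in> A \<Longrightarrow> b \<in> B \<Longrightarrow> a \<odot> b \<in> product_space A B"
  unfolding product_space_def by (rule span_base) blast

lemma product_space_least:
  assumes "subspace C" "\<And>a b. a \<in> A \<Longrightarrow> b \<in> B \<Longrightarrow> a \<odot> b \<in> C"
  shows "product_space A B \<subseteq> C"
  unfolding product_space_def using assms by (intro span_minimal) auto

lemma product_space_mono: "A \<subseteq> A' \<Longrightarrow> B \<subseteq> B' \<Longrightarrow> product_space A B \<subseteq> product_space A' B'"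
  by (rule product_space_least[OF subspace_product_space]) (auto intro: product_spaceI)

lemma mult_mem_of_span:
  assumes "a \<in> span A" "b \<in> span B" "subspace C" "\<And>a b. a \<in> A \<Longrightarrow> b \<in> B \<Longrightarrow> a \<odot> b \<in> C"
  shows "a \<odot> b \<in> C"
proof -
  have "span A \<subseteq> {a. a \<odot> y \<in> C}" if "y \<in> B" for y
    using assms that by (intro span_minimal subspace_vimage_left) auto
  then have "span B \<subseteq> {b. a \<odot> b \<in> C}"
    using assms by (intro span_minimal subspace_vimage_right) auto
  then show ?thesis using assms(2) by auto
qed

lemma product_space_span_left: "product_space (span A) B = product_space A B"
proof
  show "product_space (span A) B \<subseteq> product_space A B"
    using mult_mem_of_span[OF _ span_base subspace_product_space product_spaceI]
    by (intro product_space_least[OF subspace_product_space])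
  show "product_space A B \<subseteq> product_space (span A) B"
    by (intro product_space_mono span_superset order_refl)
qed

section \<open>The filtration by iterated left multiplication\<close>

primrec iterated_product :: "'b set \<Rightarrow> nat \<Rightarrow> 'b set"
  where
    "iterated_product A 0 = UNIV"
  | "iterated_product A (Suc n) = product_space A (iterated_product A n)"

text \<open>As \<open>iterated_product\<close> starts from \<open>UNIV\<close>, this says that any
  \<open>n\<close> left multiplications by elements of \<open>A\<close> compose to zero.\<close>

definition acts_nilpotently :: "'b set \<Rightarrow> bool"
  where "acts_nilpotently A \<longleftrightarrow> (\<exists>n. iterated_product A n \<subseteq> {0})"

lemma subspace_iterated_product: "subspace (iterated_product A n)"
  by (cases n) (simp_all add: subspace_product_space)

lemma iterated_product_mono: "A \<subseteq> B \<Longrightarrow> iterated_product A n \<subseteq> iterated_product B n"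
  by (induction n) (simp_all add: product_space_mono)

lemma iterated_product_Suc_subset: "iterated_product A (Suc n) \<subseteq> iterated_product A n"
proof (induction n)
  case (Suc n)
  then show ?case using product_space_mono[OF order_refl Suc] by simp
qed simp

lemma iterated_product_span: "iterated_product (span A) n = iterated_product A n"
  by (induction n) (simp_all add: product_space_span_left)

lemma acts_nilpotently_mono: "A \<subseteq> B \<Longrightarrow> acts_nilpotently B \<Longrightarrow> acts_nilpotently A"
  unfolding acts_nilpotently_def using iterated_product_mono by blast

lemma acts_nilpotently_span [simp]: "acts_nilpotently (span A) \<longleftrightarrow> acts_nilpotently A"
  by (simp add: acts_nilpotently_def iterated_product_span)

lemma funpow_mult_mem_iterated_product:
  assumes "y \<in> A" shows "((\<odot>) y ^^ n) z \<in> iterated_product A n"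
  using assms by (induction n) (auto intro: product_spaceI)

text \<open>The Engel step: \<open>x \<odot> (s \<odot> z) = s \<odot> (x \<odot> z) - (s \<odot> x)
  \<odot> z\<close> shows that \<open>x\<close> preserves each term of the filtration by
  \<open>S\<close>. Adding \<open>x\<close> multiplies the length by at most
  \<open>m\<close>.\<close>

lemma acts_nilpotently_insert:
  assumes S: "acts_nilpotently S" and Sx: "\<And>s. s \<in> S \<Longrightarrow> s \<odot> x \<in> span S"
    and x: "\<And>z. ((\<odot>) x ^^ m) z = 0"
  shows "acts_nilpotently (insert x S)"
proof -
  let ?I = "iterated_product S" and ?J = "iterated_product (insert x S)"
  have x_inv: "x \<odot> z \<in> ?I j" if "z \<in> ?I j" for z j
    using that
  proof (induction j arbitrary: z)
    case (Suc j)
    have "product_space S (?I j) \<subseteq> {z. x \<odot> z \<in> ?I (Suc j)}"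
    proof (rule product_space_least[OF subspace_vimage_right[OF subspace_iterated_product]], rule CollectI)
      fix s z assume s: "s \<in> S" and z: "z \<in> ?I j"
      have "x \<odot> (s \<odot> z) = s \<odot> (x \<odot> z) - (s \<odot> x) \<odot> z"
        using left_leibniz[of s x z] by simp
      moreover have "s \<odot> (x \<odot> z) \<in> ?I (Suc j)"
        using s Suc.IH[OF z] by (auto intro: product_spaceI)
      moreover have "(s \<odot> x) \<odot> z \<in> ?I (Suc j)"
        using product_spaceI[OF Sx[OF s] z] by (simp add: product_space_span_left)
      ultimately show "x \<odot> (s \<odot> z) \<in> ?I (Suc j)"
        by (simp only: subspace_diff[OF subspace_iterated_product])
    qed
    then show ?case using Suc.prems by auto
  qed simp
  have x_pow: "((\<odot>) x ^^ i) z \<in> ?I j" if "z \<in> ?I j" for z i j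
    using that by (induction i) (auto intro: x_inv)
  \<comment> \<open>\<open>S\<close> maps \<open>I j\<close> to \<open>I (j + 1)\<close> and \<open>x\<close> preserves both, so \<open>m\<close> steps lead from one to the other.\<close>
  have "?J (m * j) \<subseteq> ?I j" for j
  proof (induction j)
    case (Suc j)
    \<comment> \<open>Of \<open>i\<close> further factors either one lies in \<open>S\<close>, which
      leads into \<open>?I (Suc j)\<close>, or all are \<open>x\<close>; the second case dies at
      \<open>i = m\<close>.\<close>
    have "?J (m * j + i) \<subseteq> span (?I (Suc j) \<union> ((\<odot>) x ^^ i) ` ?I j)" for i
    proof (induction i)
      case 0
      show ?case using Suc by (auto intro: span_base)
    next
      case (Suc i)
      let ?U = "\<lambda>i. ?I (Suc j) \<union> ((\<odot>) x ^^ i) ` ?I j"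
      have gen: "a \<odot> b \<in> span (?U (Suc i))" if a: "a \<in> insert x S" and b: "b \<in> ?U i" for a b
      proof (cases "b \<in> ?I (Suc j)")
        case True
        then have "a \<odot> b \<in> ?I (Suc j)"
          using a x_inv[OF True] iterated_product_Suc_subset[of S "Suc j"] product_spaceI[of a S b "?I (Suc j)"]
          by auto
        then show ?thesis by (intro span_base) blast
      next
        case False
        then obtain c where c: "c \<in> ?I j" "b = ((\<odot>) x ^^ i) c" using b by blast
        show ?thesis
        proof (cases "a = x")
          case True
          then show ?thesis using c by (intro span_base) auto
        next
          case False
          then have "a \<odot> b \<in> ?I (Suc j)"
            using a x_pow[OF c(1)] c(2) by (auto intro: product_spaceI)
          then show ?thesis by (intro span_base) blast
        qed
      qed
      have "product_space (insert x S) (?J (m * j + i)) \<subseteq> span (?U (Suc i))"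
      proof (rule product_space_least[OF subspace_span])
        fix a b assume "a \<in> insert x S" and b: "b \<in> ?J (m * j + i)"
        then show "a \<odot> b \<in> span (?U (Suc i))"
          by (intro mult_mem_of_span[OF span_base subsetD[OF Suc b] subspace_span gen])
      qed
      then show ?case by simp
    qed
    from this[of m] have "?J (m * j + m) \<subseteq> span (?I (Suc j) \<union> ((\<odot>) x ^^ m) ` ?I j)" .
    also have "\<dots> \<subseteq> ?I (Suc j)"
      by (rule span_minimal[OF _ subspace_iterated_product])
        (use x subspace_0[OF subspace_iterated_product, of S "Suc j"] in auto)
    finally show ?case by (simp add: add.commute)
  qed simp
  then show ?thesis using S unfolding acts_nilpotently_def by (meson subset_trans)
qed

text \<open>Left multiplications are derivations, so the left ideal property passes from a subspace
  to its square.\<close>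

lemma mult_derived_series: "y \<in> derived_series n \<Longrightarrow> x \<odot> y \<in> derived_series n"
proof (induction n arbitrary: x y)
  case (Suc n)
  have "product_space (derived_series n) (derived_series n) \<subseteq> {y. x \<odot> y \<in> derived_series (Suc n)}"
    using Suc.IH
    by (intro product_space_least subspace_vimage_right)
      (auto simp: left_leibniz[of x] subspace_product_space
        intro!: subspace_add[OF subspace_product_space] product_spaceI)
  then show ?case using Suc.prems by auto
qed simp

lemma subspace_derived_series: "subspace (derived_series n)"
  by (cases n) (simp_all add: subspace_product_space)

lemma derived_series_Suc_subset: "derived_series (Suc n) \<subseteq> derived_series n"
  unfolding derived_series.simps
  by (rule product_space_least[OF subspace_derived_series mult_derived_series])

lemma mult_iterated_product:
  assumes I: "\<And>x i. i \<in> I \<Longrightarrow> x \<odot> i \<in> I"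
  shows "z \<in> iterated_product I n \<Longrightarrow> x \<odot> z \<in> iterated_product I n"
proof (induction n arbitrary: x z)
  case (Suc n)
  have "product_space I (iterated_product I n) \<subseteq> {z. x \<odot> z \<in> iterated_product I (Suc n)}"
    using Suc.IH I
    by (intro product_space_least subspace_vimage_right)
      (auto simp: left_leibniz[of x] subspace_product_space
        intro!: subspace_add[OF subspace_product_space] product_spaceI)
  then show ?case using Suc.prems by auto
qed simp

end

context finite_dimensional_left_leibniz_algebra
begin

text \<open>Choose \<open>S \<subseteq> N\<close> acting nilpotently with span of largest dimension; if \<open>span S\<close> missed some
  element of \<open>N\<close>, applying elements of \<open>S\<close> to it would lead to an \<open>x\<close> that \<open>S\<close> maps into \<open>span S\<close>,
  and \<open>insert x S\<close> would still act nilpotently.\<close>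

lemma acts_nilpotently_of_nilpotent:
  assumes closed: "\<And>x y. x \<in> N \<Longrightarrow> y \<in> N \<Longrightarrow> x \<odot> y \<in> N"
    and nil: "\<And>x. x \<in> N \<Longrightarrow> \<exists>m. \<forall>z. ((\<odot>) x ^^ m) z = 0"
  shows "acts_nilpotently N"
proof -
  define P where "P = (\<lambda>S. S \<subseteq> N \<and> acts_nilpotently S)"
  have "iterated_product {} 1 \<subseteq> {0}" by (simp add: product_space_def)
  then have "P {}" unfolding P_def acts_nilpotently_def by blast
  moreover have "\<forall>S. P S \<longrightarrow> dim S < Suc dimension"
    by (simp add: dim_subset_UNIV less_Suc_eq_le)
  ultimately have "\<exists>S. P S \<and> (\<forall>S'. P S' \<longrightarrow> dim S' \<le> dim S)"
    by (rule Lattices_Big.ex_has_greatest_nat)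
  then obtain S where S: "P S" and max: "\<And>S'. P S' \<Longrightarrow> dim S' \<le> dim S" by blast
  obtain k where k: "iterated_product S k \<subseteq> {0}" using S unfolding P_def acts_nilpotently_def by blast
  have "N \<subseteq> span S"
  proof (rule ccontr)
    assume "\<not> N \<subseteq> span S"
    have "\<exists>x\<in>N. x \<notin> span S \<and> (\<forall>s\<in>S. s \<odot> x \<in> span S)"
    proof (rule ccontr)
      assume none: "\<not> ?thesis"
      \<comment> \<open>Without such an \<open>x\<close>, multiplying by elements of
        \<open>S\<close> could always be continued outside \<open>span S\<close>, yet after
        \<open>k\<close> steps it reaches 0.\<close>
      have "\<exists>x\<in>N. x \<notin> span S \<and> x \<in> iterated_product S j" for j
      proof (induction j)
        case 0
        show ?case using \<open>\<not> N \<subseteq> span S\<close> by auto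
      next
        case (Suc j)
        then obtain x where x: "x \<in> N" "x \<notin> span S" "x \<in> iterated_product S j" by blast
        then obtain s where s: "s \<in> S" "s \<odot> x \<notin> span S" using none by blast
        then have "s \<odot> x \<in> N" using closed x S unfolding P_def by blast
        then show ?case using s x by (auto intro: product_spaceI)
      qed
      then show False using k span_zero by blast
    qed
    then obtain x where x: "x \<in> N" "x \<notin> span S" "\<And>s. s \<in> S \<Longrightarrow> s \<odot> x \<in> span S" by blast
    obtain m where "\<And>z. ((\<odot>) x ^^ m) z = 0" using nil[OF x(1)] by blast
    then have "P (insert x S)"
      using S x acts_nilpotently_insert unfolding P_def by blast
    then have "dim (insert x S) \<le> dim S" by (rule max)
    then show False using x(2) by (simp add: dim_insert)
  qed
  then show ?thesis
    using S acts_nilpotently_mono[of N "span S"] unfolding P_def by simp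
qed

end

locale finite_dimensional_left_leibniz_algebra_char_0 =
  finite_dimensional_left_leibniz_algebra scale Basis mult +
  finite_dimensional_vector_space_char_0 scale Basis
  for scale :: "'a::field_char_0 \<Rightarrow> 'b::ab_group_add \<Rightarrow> 'b"
    and Basis :: "'b set"
    and mult :: "'b \<Rightarrow> 'b \<Rightarrow> 'b" (infixl "\<odot>" 70)
begin

lemma endo_mult: "endo ((\<odot>) x)"
  by (simp add: endo_iff mult_add_right mult_scale_right)

lemma endo_trace_lowering:
  assumes A: "acts_nilpotently A" and f: "endo f"
    and lower: "\<And>n z. z \<in> iterated_product A n \<Longrightarrow> f z \<in> iterated_product A (Suc n)"
  shows "endo_trace f = 0"
proof -
  obtain n where n: "iterated_product A n \<subseteq> {0}" using A unfolding acts_nilpotently_def by blast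
  have "(f ^^ n) z \<in> iterated_product A n" for n z
    by (induction n) (use lower in auto)
  then have "(f ^^ n) z = 0" for z using n by blast
  then show ?thesis by (rule endo_trace_nilpotent[OF f])
qed

text \<open>In \<open>tr L_y^k\<close> one factor \<open>L_y\<close> is expanded into commutators of
  \<open>L_a\<close> and \<open>L_b\<close>; having \<open>b \<odot> y\<close> in \<open>I\<close>
  makes \<open>L_b\<close> commute with \<open>L_y\<close> up to operators that lower the filtration
  by \<open>I\<close>.\<close>

lemma nilpotent_of_commutators:
  assumes I: "acts_nilpotently I" "\<And>x i. i \<in> I \<Longrightarrow> x \<odot> i \<in> I"
    and y: "y \<in> span {a \<odot> b | a b. b \<odot> y \<in> I}"
  shows "\<exists>m. \<forall>z. ((\<odot>) y ^^ m) z = 0"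
proof (rule nilpotent_of_trace_powers[OF endo_mult])
  fix k :: nat assume "k > 0"
  then obtain m where k: "k = Suc m" by (cases k) auto
  let ?y = "(\<odot>) y ^^ m"
  interpret y: Vector_Spaces.linear scale scale ?y by (rule endo_funpow[OF endo_mult])
  have pow: "?y z \<in> iterated_product I n" if "z \<in> iterated_product I n" for z n
    using that by (induction m) (auto intro: mult_iterated_product I)
  have comm: "b \<odot> ((\<odot>) y ^^ l) z - ((\<odot>) y ^^ l) (b \<odot> z) \<in> iterated_product I (Suc n)"
    if b: "b \<odot> y \<in> I" and z: "z \<in> iterated_product I n" for b z l n
  proof (induction l)
    case 0
    show ?case using subspace_0[OF subspace_product_space] by simp
  next
    case (Suc l)
    let ?z = "((\<odot>) y ^^ l) z"
    have "?z \<in> iterated_product I n"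
      using z by (induction l) (auto intro: mult_iterated_product I)
    then have 1: "(b \<odot> y) \<odot> ?z \<in> iterated_product I (Suc n)"
      using b by (auto intro: product_spaceI)
    have 2: "y \<odot> (b \<odot> ?z - ((\<odot>) y ^^ l) (b \<odot> z)) \<in> iterated_product I (Suc n)"
      by (rule mult_iterated_product[OF I(2) Suc])
    have "b \<odot> ((\<odot>) y ^^ Suc l) z - ((\<odot>) y ^^ Suc l) (b \<odot> z)
        = (b \<odot> y) \<odot> ?z + y \<odot> (b \<odot> ?z - ((\<odot>) y ^^ l) (b \<odot> z))"
      by (simp add: left_leibniz[of b y] mult_diff_right)
    then show ?case using subspace_add[OF subspace_iterated_product 1 2] by simp
  qed
  \<comment> \<open>\<open>tr (y\<^sup>m [a, b]) = tr ([b, y\<^sup>m] a)\<close>, and \<open>[b, y\<^sup>m]\<close> lowers the filtration defined by \<open>I\<close>.\<close>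
  let ?Q = "{w. endo_trace (\<lambda>v. ?y (w \<odot> v)) = 0}"
  have "span {a \<odot> b | a b. b \<odot> y \<in> I} \<subseteq> ?Q"
  proof (rule span_minimal)
    show "subspace ?Q"
      by (auto simp: subspace_def mult_add_left mult_scale_left y.add y.scale y.zero
          endo_trace_add endo_trace_scale)
    show "{a \<odot> b | a b. b \<odot> y \<in> I} \<subseteq> ?Q"
    proof clarify
      fix a b assume b: "b \<odot> y \<in> I"
      have "endo_trace (\<lambda>v. ?y (a \<odot> (b \<odot> v))) = endo_trace (\<lambda>v. b \<odot> ?y (a \<odot> v))"
        using endo_trace_commute[of "\<lambda>v. ?y (a \<odot> v)" "(\<odot>) b"]
        by (simp add: endo_compose endo_funpow endo_mult)
      then have "endo_trace (\<lambda>v. ?y ((a \<odot> b) \<odot> v))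
          = endo_trace (\<lambda>v. b \<odot> ?y (a \<odot> v) - ?y (b \<odot> (a \<odot> v)))"
        by (simp add: mult_mult_left y.diff endo_trace_diff)
      also have "\<dots> = 0"
      proof (rule endo_trace_lowering[OF I(1)])
        show "endo (\<lambda>v. b \<odot> ?y (a \<odot> v) - ?y (b \<odot> (a \<odot> v)))"
          by (intro endo_diff endo_compose[OF endo_mult] endo_compose[OF endo_funpow[OF endo_mult]] endo_mult)
        fix n z assume "z \<in> iterated_product I n"
        then have "a \<odot> z \<in> iterated_product I n" by (rule mult_iterated_product[rotated]) (rule I(2))
        then show "b \<odot> ?y (a \<odot> z) - ?y (b \<odot> (a \<odot> z)) \<in> iterated_product I (Suc n)"
          by (rule comm[OF b])
      qed
      finally show "endo_trace (\<lambda>v. ?y ((a \<odot> b) \<odot> v)) = 0" .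
    qed
  qed
  with y have "endo_trace (\<lambda>v. ?y (y \<odot> v)) = 0" by blast
  then show "endo_trace ((\<odot>) y ^^ k) = 0" by (simp add: k funpow_Suc_right comp_def del: funpow.simps)
qed

text \<open>For \<open>y\<close> in \<open>?D\<close> and arbitrary \<open>b\<close>, the product
  \<open>b \<odot> y\<close> need not lie in \<open>?D'\<close>, hence two rounds: first the
  products \<open>x \<odot> y\<close> themselves, then \<open>?D\<close> by means of the left ideal
  \<open>E\<close> they span.\<close>

lemma acts_nilpotently_derived_step:
  assumes "acts_nilpotently (derived_series (Suc (Suc n)))"
  shows "acts_nilpotently (derived_series (Suc n))"
proof -
  let ?D = "derived_series (Suc n)" and ?D' = "derived_series (Suc (Suc n))"
  \<comment> \<open>Adding \<open>?D'\<close> makes the set closed: any two elements of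
    \<open>?D\<close> multiply into \<open>?D'\<close>.\<close>
  let ?N = "{x \<odot> y | x y. y \<in> ?D} \<union> ?D'"
  have N: "?N \<subseteq> ?D" using derived_series_Suc_subset mult_derived_series by blast
  have DD: "x \<odot> y \<in> ?D'" if "x \<in> ?D" "y \<in> ?D" for x y
    using product_spaceI[OF that] by simp
  have "acts_nilpotently ?N"
  proof (rule acts_nilpotently_of_nilpotent)
    show "x \<odot> y \<in> ?N" if "x \<in> ?N" "y \<in> ?N" for x y
      using DD[of x y] that N by blast
    fix z assume "z \<in> ?N"
    then consider x y where "z = x \<odot> y" "y \<in> ?D" | "z \<in> ?D'" by blast
    then show "\<exists>m. \<forall>v. ((\<odot>) z ^^ m) v = 0"
    proof cases
      case 1
      then have "y \<odot> z \<in> ?D'" using DD mult_derived_series by blast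
      then have "z \<in> span {a \<odot> b | a b. b \<odot> z \<in> ?D'}" using 1 by (intro span_base) blast
      then show ?thesis using nilpotent_of_commutators[OF assms] mult_derived_series by blast
    next
      case 2
      obtain m where "iterated_product ?D' m \<subseteq> {0}" using assms unfolding acts_nilpotently_def by blast
      then show ?thesis using funpow_mult_mem_iterated_product[OF 2] by blast
    qed
  qed
  moreover define E where "E = product_space UNIV ?D"
  have E: "E \<subseteq> span ?N"
    unfolding E_def product_space_def by (intro span_mono) blast
  ultimately have E_nil: "acts_nilpotently E"
    using acts_nilpotently_mono[OF E] by simp
  have "E \<subseteq> ?D"
    unfolding E_def by (intro product_space_least subspace_derived_series mult_derived_series)
  then have E_ideal: "x \<odot> i \<in> E" if "i \<in> E" for x i
    using that unfolding E_def by (auto intro: product_spaceI)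
  show ?thesis
  proof (rule acts_nilpotently_of_nilpotent)
    show "x \<odot> y \<in> ?D" if "x \<in> ?D" "y \<in> ?D" for x y
      using mult_derived_series[OF that(2)] .
    fix y assume y: "y \<in> ?D"
    then have "b \<odot> y \<in> E" for b unfolding E_def by (auto intro: product_spaceI)
    then have "{a \<odot> b | a b. a \<in> derived_series n \<and> b \<in> derived_series n}
        \<subseteq> {a \<odot> b | a b. b \<odot> y \<in> E}" by blast
    then have "y \<in> span {a \<odot> b | a b. b \<odot> y \<in> E}"
      using y span_mono unfolding derived_series.simps product_space_def by blast
    then show "\<exists>m. \<forall>z. ((\<odot>) y ^^ m) z = 0"
      using nilpotent_of_commutators[OF E_nil E_ideal] by blast
  qed
qed

text \<open>Downward induction from \<open>r\<close>, where the derived series has reached 0. It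
  stops at index 1: the whole algebra need not act nilpotently.\<close>

lemma acts_nilpotently_derived_of_solvable:
  assumes solvable
  shows "acts_nilpotently (derived_series 1)"
proof -
  obtain r where r: "derived_series r = {0}" using assms unfolding solvable_def by blast
  have "iterated_product {0} 1 \<subseteq> {0}" by (simp add: product_space_def)
  then have "acts_nilpotently {0}" unfolding acts_nilpotently_def by blast
  moreover have "derived_series (Suc r) \<subseteq> {0}" using derived_series_Suc_subset[of r] r by simp
  ultimately have base: "acts_nilpotently (derived_series (Suc r))"
    using acts_nilpotently_mono by blast
  have "acts_nilpotently (derived_series (Suc (r - i)))" if "i \<le> r" for i
    using that
  proof (induction i)
    case (Suc i)
    then have "r - i = Suc (r - Suc i)" by simp
    then show ?case using Suc acts_nilpotently_derived_step[of "r - Suc i"] by simp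
  qed (use base in simp)
  from this[of r] show ?thesis by simp
qed

section \<open>The Killing form\<close>

lemma killing_form_eq: "killing_form x y = endo_trace (\<lambda>v. x \<odot> (y \<odot> v))"
  by (simp add: killing_form_def left_mult_def comp_def)

text \<open>\<open>L_y\<close> lowers the filtration by the derived algebra and \<open>L_x\<close>
  preserves it, so their composite has trace 0.\<close>

lemma killing_form_zero_of_solvable:
  assumes solvable "y \<in> product_space UNIV UNIV"
  shows "killing_form x y = 0"
  unfolding killing_form_eq
proof (rule endo_trace_lowering[OF acts_nilpotently_derived_of_solvable[OF assms(1)]])
  show "endo (\<lambda>v. x \<odot> (y \<odot> v))" by (intro endo_compose[OF endo_mult] endo_mult)
  fix n z assume "z \<in> iterated_product (derived_series 1) n"
  then have "y \<odot> z \<in> iterated_product (derived_series 1) (Suc n)"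
    using assms(2) by (auto intro: product_spaceI)
  then show "x \<odot> (y \<odot> z) \<in> iterated_product (derived_series 1) (Suc n)"
    by (rule mult_iterated_product[rotated]) (rule mult_derived_series)
qed

text \<open>For a replica \<open>?q\<close> of \<open>L_y\<close>, the trace of
  \<open>[L_a, L_b] ?q\<close> equals that of \<open>L_a [L_b, ?q]\<close>, which is
  \<open>- killing_form a c\<close> for some \<open>c\<close> in the derived algebra. By linearity
  the trace of \<open>L_y ?q\<close> vanishes.\<close>

lemma nilpotent_of_killing_form_zero:
  assumes killing: "\<And>x y. y \<in> product_space UNIV UNIV \<Longrightarrow> killing_form x y = 0"
    and y: "y \<in> product_space UNIV UNIV"
  shows "\<exists>m. \<forall>z. ((\<odot>) y ^^ m) z = 0"
proof (rule nilpotent_of_trace_replicas[OF endo_mult])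
  fix q r
  assume r0: "coeff r 0 = 0" and replica: "\<And>Z v. endo Z \<Longrightarrow>
    poly_endo ((\<odot>) y) q (Z v) - Z (poly_endo ((\<odot>) y) q v)
      = umbral_sum (\<lambda>k c. scale c (((\<lambda>Y w. y \<odot> Y w - Y (y \<odot> w)) ^^ k) Z v)) r"
  let ?q = "poly_endo ((\<odot>) y) q"
  have q: "endo ?q" by (rule endo_poly_endo[OF endo_mult])
  have "product_space UNIV UNIV \<subseteq> {w. endo_trace (\<lambda>v. w \<odot> ?q v) = 0}"
  proof (rule product_space_least)
    show "subspace {w. endo_trace (\<lambda>v. w \<odot> ?q v) = 0}"
      by (auto simp: subspace_def mult_add_left mult_scale_left endo_trace_add endo_trace_scale)
    fix a b
    have ad: "((\<lambda>Y w. y \<odot> Y w - Y (y \<odot> w)) ^^ k) ((\<odot>) b) v = ((\<odot>) y ^^ k) b \<odot> v" for k v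
      by (induction k arbitrary: v) (simp_all add: mult_mult_left)
    define c where "c = poly_endo ((\<odot>) y) r b"
    \<comment> \<open>The vanishing constant term of \<open>r\<close> matters here: \<open>b\<close>
      itself may lie outside the derived algebra, but positive powers of \<open>L_y\<close> map it
      inside.\<close>
    have "scale (coeff r k) (((\<odot>) y ^^ k) b) \<in> product_space UNIV UNIV" for k
      by (cases k) (auto simp: r0 intro: product_spaceI subspace_0 subspace_scale subspace_product_space)
    then have c: "c \<in> product_space UNIV UNIV"
      unfolding c_def poly_endo_def umbral_sum_def by (intro subspace_sum subspace_product_space)
    have sum_left: "(\<Sum>k\<in>A. h k) \<odot> v = (\<Sum>k\<in>A. h k \<odot> v)" for A :: "nat set" and h v
      by (induction A rule: infinite_finite_induct) (simp_all add: mult_add_left)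
    have comm: "?q (b \<odot> v) - b \<odot> ?q v = c \<odot> v" for v
      using replica[OF endo_mult, of b v]
      by (simp add: ad c_def poly_endo_def umbral_sum_def sum_left mult_scale_left)
    have "endo_trace (\<lambda>v. b \<odot> (a \<odot> ?q v)) = endo_trace (\<lambda>v. a \<odot> ?q (b \<odot> v))"
      using endo_trace_commute[of "(\<odot>) b" "\<lambda>v. a \<odot> ?q v"]
      by (simp add: endo_compose endo_mult q)
    then have "endo_trace (\<lambda>v. (a \<odot> b) \<odot> ?q v)
        = endo_trace (\<lambda>v. a \<odot> (b \<odot> ?q v)) - endo_trace (\<lambda>v. a \<odot> ?q (b \<odot> v))"
      by (simp add: mult_mult_left endo_trace_diff)
    also have "\<dots> = - endo_trace (\<lambda>v. a \<odot> ?q (b \<odot> v) - a \<odot> (b \<odot> ?q v))"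
      by (simp add: endo_trace_diff)
    also have "\<dots> = - killing_form a c"
      by (simp add: killing_form_eq comm flip: mult_diff_right)
    finally show "a \<odot> b \<in> {w. endo_trace (\<lambda>v. w \<odot> ?q v) = 0}"
      using killing[OF c] by simp
  qed
  then show "endo_trace (\<lambda>v. y \<odot> ?q v) = 0" using y by blast
qed

text \<open>Each further term of the derived series gains a left factor from the derived algebra, so
  the series is dominated by the filtration.\<close>

lemma solvable_of_killing_form_zero:
  assumes "\<And>x y. y \<in> product_space UNIV UNIV \<Longrightarrow> killing_form x y = 0"
  shows solvable
proof -
  let ?D = "derived_series 1"
  have "acts_nilpotently ?D"
    by (rule acts_nilpotently_of_nilpotent)
      (use nilpotent_of_killing_form_zero[OF assms] in \<open>auto intro: product_spaceI\<close>)
  then obtain n where n: "iterated_product ?D n \<subseteq> {0}" unfolding acts_nilpotently_def by blast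
  have D: "derived_series (Suc i) \<subseteq> ?D" for i
  proof (induction i)
    case (Suc i)
    then show ?case using derived_series_Suc_subset[of "Suc i"] by blast
  qed simp
  have "derived_series (Suc i) \<subseteq> iterated_product ?D i" for i
  proof (induction i)
    case (Suc i)
    then show ?case using product_space_mono[OF D Suc, of i] by simp
  qed simp
  then have "derived_series (Suc n) \<subseteq> {0}" using n by blast
  then have "derived_series (Suc n) = {0}"
    using subspace_0[OF subspace_derived_series] by blast
  then show ?thesis unfolding solvable_def by blast
qed

end

theorem theorem6p8:
  fixes scale :: "'k::field_char_0 \<Rightarrow> 'v::ab_group_add \<Rightarrow> 'v"
    and Basis :: "'v set"
    and mult :: "'v \<Rightarrow> 'v \<Rightarrow> 'v"
  assumes "finite_dimensional_left_leibniz_algebra scale Basis mult"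
  shows "left_leibniz_algebra.solvable scale mult \<longleftrightarrow>
    (\<forall>x. \<forall>y \<in> left_leibniz_algebra.product_space scale mult UNIV UNIV.
      finite_dimensional_left_leibniz_algebra.killing_form scale Basis mult x y = 0)"
proof -
  interpret finite_dimensional_left_leibniz_algebra scale Basis mult by (rule assms)
  interpret finite_dimensional_left_leibniz_algebra_char_0 scale Basis mult ..
  show ?thesis
    using killing_form_zero_of_solvable solvable_of_killing_form_zero by blast
qed

end
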